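(* Let $u_0\in C([0,1])$ (possibly random) with $u_0\ge0$, $\int_0^1u_0>0$ and $u_0$, $W$ independent. Let $(u^1,\eta^1,W)$ and $(u^2,\eta^2,W)$ be two weak solutions of the reflected stochastic Cahn–Hilliard equation, defined on the same probability space with the same driving noise $W$, with $u^1_0=u^2_0=u_0$. Then $(u^1,\eta^1)=(u^2,\eta^2)$.
   Context: $\langle\cdot,\cdot\rangle_L$ is the scalar product of $L^2(0,1)$. $A=\partial_\theta^2$ with domain $D(A)=\{h\in H^2(0,1):h'(0)=h'(1)=0\}$; $D(A^2)=\{h\in D(A):Ah\in D(A)\}$; $\overline h=\int_0^1h$. $H$ is the completion of $L^2(0,1)$ for $(h,k)_H:=\langle\overline Qh,k\rangle_L$, where $\overline Qh=(-A)^{-1}(h-\overline h)+\overline h$. The reflected stochastic Cahn–Hilliard equation is formally $\partial_tu=-\frac12\partial_\theta^2(\partial_\theta^2u+\eta)+\partial_\theta\dot W$ on $[0,1]$, with $\partial_\theta u=\partial_\theta^3u=0$ at $\theta=0,1$, $u\ge0$, $\eta\ge0$, $\int u\,d\eta=0$. Precisely, $(u,\eta,W)$ on a filtered complete probability space $(\Omega,\mathbb P,\mathcal F,\mathcal F_t)$ is a *weak solution* on $[0,T]$ if: (1) a.s. $u\in C((0,T]\times[0,1])$, $u\ge0$ and $u\in C([0,T];H)$; (2) a.s. $\eta$ is a positive measure on $(0,T]\times[0,1]$ such that $\eta([\delta,T]\times[0,1])<\infty$ for all $\delta\in(0,T]$; (3) $W$ is a Brownian sheet, i.e. centered Gaussian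 with $\mathbb E[W(t,\theta)W(t',\theta')]=(t\wedge t')(\theta\wedge\theta')$; (4) $u_0$ and $W$ are independent and $t\mapsto(u_t(\theta),W(t,\theta))$ is $(\mathcal F_t)$-adapted for all $\theta\in[0,1]$; (5) for all $h\in D(A^2)$ and $0<\delta\le t\le T$, $$\langle u_t,h\rangle_L=\langle u_\delta,h\rangle_L-\tfrac12\int_\delta^t\langle u_s,A^2h\rangle_L\,ds-\tfrac12\int_\delta^t\int_0^1Ah_\theta\,\eta(ds,d\theta)-\int_\delta^t\int_0^1h'_\theta\,W(ds,d\theta);$$ (6) a.s. $\int_{(0,T]\times[0,1]}u\,d\eta=0$. Equality of solutions is almost sure equality. *)

theory Defs
  imports "HOL-Probability.Probability"
begin

section \<open>Function spaces on the unit interval\<close>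

text \<open>
  Elements of \<open>L\<^sup>2(0,1)\<close> are represented by functions \<open>real \<Rightarrow> real\<close>; only their values
  on \<open>[0,1]\<close> matter.
\<close>

definition L2 :: "(real \<Rightarrow> real) \<Rightarrow> bool" where
  "L2 f \<longleftrightarrow> f \<in> borel_measurable (lebesgue_on {0..1}) \<and>
           integrable (lebesgue_on {0..1}) (\<lambda>x. (f x)\<^sup>2)"

definition inner_L :: "(real \<Rightarrow> real) \<Rightarrow> (real \<Rightarrow> real) \<Rightarrow> real" where
  "inner_L f g = (LINT x|lebesgue_on {0..1}. f x * g x)"

definition mean :: "(real \<Rightarrow> real) \<Rightarrow> real" where
  "mean f = (LINT x|lebesgue_on {0..1}. f x)"

text \<open>
  \<open>H1_deriv f g\<close>: \<open>f\<close> is the continuous representative of an element of the Sobolev space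
  \<open>H\<^sup>1(0,1)\<close> and \<open>g\<close> is (a version of) its weak derivative.  In dimension one, these are the
  absolutely continuous functions with square integrable derivative.  If \<open>g\<close> is continuous, then
  \<open>f\<close> is continuously differentiable on \<open>[0,1]\<close> with classical derivative \<open>g\<close>.
\<close>

definition H1_deriv :: "(real \<Rightarrow> real) \<Rightarrow> (real \<Rightarrow> real) \<Rightarrow> bool" where
  "H1_deriv f g \<longleftrightarrow> L2 g \<and> (\<forall>x\<in>{0..1}. f x = f 0 + (LINT y|lebesgue_on {0..x}. g y))"

text \<open>
  \<open>dom_A h h' k\<close>: \<open>h \<in> D(A)\<close>, that is, \<open>h \<in> H\<^sup>2(0,1)\<close> with \<open>h'(0) = h'(1) = 0\<close>; moreover \<open>h'\<close>
  is its (continuous) derivative, and \<open>k = A h\<close> almost everywhere.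
\<close>

definition dom_A :: "(real \<Rightarrow> real) \<Rightarrow> (real \<Rightarrow> real) \<Rightarrow> (real \<Rightarrow> real) \<Rightarrow> bool" where
  "dom_A h h' k \<longleftrightarrow> H1_deriv h h' \<and> H1_deriv h' k \<and> h' 0 = 0 \<and> h' 1 = 0"

text \<open>
  \<open>dom_A2 h h' Ah A2h\<close>: \<open>h \<in> D(A\<^sup>2)\<close>, that is, \<open>h \<in> D(A)\<close> and \<open>A h \<in> D(A)\<close>.  Here \<open>Ah\<close> is the
  continuous representative of \<open>A h\<close>, so that its integral against a measure makes sense.
\<close>

definition dom_A2 ::
  "(real \<Rightarrow> real) \<Rightarrow> (real \<Rightarrow> real) \<Rightarrow> (real \<Rightarrow> real) \<Rightarrow> (real \<Rightarrow> real) \<Rightarrow> bool" where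
  "dom_A2 h h' Ah A2h \<longleftrightarrow> dom_A h h' Ah \<and> (\<exists>Ah'. dom_A Ah Ah' A2h)"

text \<open>
  \<open>(-A)\<^sup>-\<^sup>1\<close> is the inverse of \<open>-A\<close> on the functions of mean zero.  The description operator picks
  a function that is unique on \<open>[0,1]\<close>.
\<close>

definition inv_minus_A :: "(real \<Rightarrow> real) \<Rightarrow> (real \<Rightarrow> real)" where
  "inv_minus_A f = (SOME g. (\<exists>g'. dom_A g g' (\<lambda>x. - f x)) \<and> mean g = 0)"

definition Qbar :: "(real \<Rightarrow> real) \<Rightarrow> (real \<Rightarrow> real)" where
  "Qbar h = (\<lambda>x. inv_minus_A (\<lambda>y. h y - mean h) x + mean h)"

definition inner_H :: "(real \<Rightarrow> real) \<Rightarrow> (real \<Rightarrow> real) \<Rightarrow> real" where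
  "inner_H h k = inner_L (Qbar h) k"

definition norm_H :: "(real \<Rightarrow> real) \<Rightarrow> real" where
  "norm_H h = sqrt (inner_H h h)"

text \<open>
  Continuity of a path with values in \<open>L\<^sup>2(0,1)\<close>, seen as a path in the completion \<open>H\<close>.  As
  \<open>L\<^sup>2(0,1)\<close> embeds isometrically into its completion, this only involves the norm of \<open>H\<close> on
  \<open>L\<^sup>2(0,1)\<close>.
\<close>

definition continuous_on_H :: "real set \<Rightarrow> (real \<Rightarrow> real \<Rightarrow> real) \<Rightarrow> bool" where
  "continuous_on_H S v \<longleftrightarrow>
     (\<forall>t\<in>S. L2 (v t)) \<and>
     (\<forall>t\<in>S. ((\<lambda>s. norm_H (\<lambda>x. v s x - v t x)) \<longlongrightarrow> 0) (at t within S))"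


section \<open>The Brownian sheet and its Wiener integral\<close>

text \<open>Centred Gaussian random variables; the degenerate one is included.\<close>

definition centered_gaussian :: "'a measure \<Rightarrow> ('a \<Rightarrow> real) \<Rightarrow> bool" where
  "centered_gaussian M X \<longleftrightarrow> X \<in> borel_measurable M \<and>
     ((AE \<omega> in M. X \<omega> = 0) \<or> (\<exists>\<sigma>>0. distributed M lborel X (normal_density 0 \<sigma>)))"

definition brownian_sheet :: "'a measure \<Rightarrow> real \<Rightarrow> (real \<Rightarrow> real \<Rightarrow> 'a \<Rightarrow> real) \<Rightarrow> bool" where
  "brownian_sheet M T W \<longleftrightarrow>
     (\<forall>I c. finite I \<and> I \<subseteq> {0..T} \<times> {0..1} \<longrightarrow>
        centered_gaussian M (\<lambda>\<omega>. \<Sum>z\<in>I. c z * W (fst z) (snd z) \<omega>)) \<and>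
     (\<forall>t\<in>{0..T}. \<forall>t'\<in>{0..T}. \<forall>\<theta>\<in>{0..1}. \<forall>\<theta>'\<in>{0..1}.
        (LINT \<omega>|M. W t \<theta> \<omega> * W t' \<theta>' \<omega>) = min t t' * min \<theta> \<theta>')"

text \<open>
  A list of tuples \<open>(c, a, b, p, q)\<close> represents the step function
  \<open>\<Sum> c \<cdot> 1\<^bsub>(a,b] \<times> (p,q]\<^esub>\<close>, whose integral with respect to \<open>W\<close> is the sum of the
  rectangular increments of \<open>W\<close>.
\<close>

type_synonym step = "(real \<times> real \<times> real \<times> real \<times> real) list"

definition valid_step :: "real \<Rightarrow> step \<Rightarrow> bool" where
  "valid_step T xs \<longleftrightarrow>
     (\<forall>(c, a, b, p, q) \<in> set xs. 0 \<le> a \<and> a \<le> b \<and> b \<le> T \<and> 0 \<le> p \<and> p \<le> q \<and> q \<le> 1)"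

definition step_fun :: "step \<Rightarrow> real \<times> real \<Rightarrow> real" where
  "step_fun xs z = (\<Sum>(c, a, b, p, q)\<leftarrow>xs. c * indicator ({a<..b} \<times> {p<..q}) z)"

definition step_integral :: "(real \<Rightarrow> real \<Rightarrow> 'a \<Rightarrow> real) \<Rightarrow> step \<Rightarrow> 'a \<Rightarrow> real" where
  "step_integral W xs \<omega> =
     (\<Sum>(c, a, b, p, q)\<leftarrow>xs. c * (W b q \<omega> - W a q \<omega> - W b p \<omega> + W a p \<omega>))"

text \<open>
  \<open>X\<close> is a version of the Wiener integral of the deterministic integrand
  \<open>f \<in> L\<^sup>2([0,T] \<times> [0,1])\<close>: the limit in \<open>L\<^sup>2(\<Omega>)\<close> of the integrals of step functions that
  approximate \<open>f\<close> in \<open>L\<^sup>2\<close>.  It exists and is almost surely unique by the isometry property of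
  the Brownian sheet; \<open>wiener_integral\<close> selects a version.
\<close>

definition is_wiener_integral ::
  "'a measure \<Rightarrow> real \<Rightarrow> (real \<Rightarrow> real \<Rightarrow> 'a \<Rightarrow> real) \<Rightarrow> (real \<times> real \<Rightarrow> real) \<Rightarrow> ('a \<Rightarrow> real) \<Rightarrow> bool"
where
  "is_wiener_integral M T W f X \<longleftrightarrow> X \<in> borel_measurable M \<and>
     (\<exists>xs :: nat \<Rightarrow> step. (\<forall>n. valid_step T (xs n)) \<and>
        (\<lambda>n. \<integral>\<^sup>+z. ennreal ((step_fun (xs n) z - f z)\<^sup>2) \<partial>lebesgue_on ({0..T} \<times> {0..1}))
          \<longlonglongrightarrow> 0 \<and>
        (\<lambda>n. \<integral>\<^sup>+\<omega>. ennreal ((step_integral W (xs n) \<omega> - X \<omega>)\<^sup>2) \<partial>M) \<longlonglongrightarrow> 0)"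

definition wiener_integral ::
  "'a measure \<Rightarrow> real \<Rightarrow> (real \<Rightarrow> real \<Rightarrow> 'a \<Rightarrow> real) \<Rightarrow> (real \<times> real \<Rightarrow> real) \<Rightarrow> 'a \<Rightarrow> real"
where
  "wiener_integral M T W f = (SOME X. is_wiener_integral M T W f X)"


section \<open>Weak solutions\<close>

text \<open>
  Independence of a random function on \<open>[0,1]\<close> and of \<open>W\<close>: independence of the \<open>\<sigma>\<close>-algebras
  generated by their evaluations.
\<close>

definition indep_initial_noise ::
  "'a measure \<Rightarrow> real \<Rightarrow> (real \<Rightarrow> 'a \<Rightarrow> real) \<Rightarrow> (real \<Rightarrow> real \<Rightarrow> 'a \<Rightarrow> real) \<Rightarrow> bool" where
  "indep_initial_noise M T u0 W \<longleftrightarrow>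
     prob_space.indep_set M
       (sets (vimage_algebra (space M) (\<lambda>\<omega>. \<lambda>\<theta>\<in>{0..1}. u0 \<theta> \<omega>)
          (PiM {0..1} (\<lambda>_. borel))))
       (sets (vimage_algebra (space M) (\<lambda>\<omega>. \<lambda>z\<in>{0..T} \<times> {0..1}. W (fst z) (snd z) \<omega>)
          (PiM ({0..T} \<times> {0..1}) (\<lambda>_. borel))))"

text \<open>
  The values of \<open>F\<close> at negative times play no role: any filtration on \<open>[0,\<infinity>)\<close> extends to the
  real line by a constant.
\<close>

definition filtered_complete_prob_space :: "'a measure \<Rightarrow> (real \<Rightarrow> 'a measure) \<Rightarrow> bool" where
  "filtered_complete_prob_space M F \<longleftrightarrow>
     prob_space M \<and> complete_measure M \<and> filtration (space M) F \<and> (\<forall>t. subalgebra M (F t))"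

text \<open>
  \<open>u t \<theta> \<omega>\<close>, \<open>W t \<theta> \<omega>\<close> and the random measure \<open>\<eta> \<omega>\<close>.  The conjuncts are, in this order: the
  probability space, then regularity of \<open>u\<close>, properties of \<open>\<eta>\<close>, the law of \<open>W\<close>, independence and
  adaptedness, the equation, and the contact condition.  The equation is required almost surely
  for each fixed \<open>h\<close>, \<open>\<delta>\<close>, \<open>t\<close>, because the Wiener integral is only defined up to null sets.
\<close>

definition weak_solution ::
  "'a measure \<Rightarrow> (real \<Rightarrow> 'a measure) \<Rightarrow> real \<Rightarrow> (real \<Rightarrow> real \<Rightarrow> 'a \<Rightarrow> real) \<Rightarrow>
   ('a \<Rightarrow> (real \<times> real) measure) \<Rightarrow> (real \<Rightarrow> real \<Rightarrow> 'a \<Rightarrow> real) \<Rightarrow> bool" where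
  "weak_solution M F T u \<eta> W \<longleftrightarrow>
     filtered_complete_prob_space M F \<and>
     (AE \<omega> in M.
        continuous_on ({0<..T} \<times> {0..1}) (\<lambda>(t, \<theta>). u t \<theta> \<omega>) \<and>
        (\<forall>t\<in>{0<..T}. \<forall>\<theta>\<in>{0..1}. u t \<theta> \<omega> \<ge> 0) \<and>
        continuous_on_H {0..T} (\<lambda>t \<theta>. u t \<theta> \<omega>)) \<and>
     (AE \<omega> in M.
        sets (\<eta> \<omega>) = sets (restrict_space borel ({0<..T} \<times> {0..1})) \<and>
        (\<forall>\<delta>\<in>{0<..T}. emeasure (\<eta> \<omega>) ({\<delta>..T} \<times> {0..1}) < \<infinity>)) \<and>
     brownian_sheet M T W \<and>
     indep_initial_noise M T (u 0) W \<and>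
     (\<forall>t\<in>{0..T}. \<forall>\<theta>\<in>{0..1}.
        u t \<theta> \<in> borel_measurable (F t) \<and> W t \<theta> \<in> borel_measurable (F t)) \<and>
     (\<forall>h h' Ah A2h \<delta> t. dom_A2 h h' Ah A2h \<and> 0 < \<delta> \<and> \<delta> \<le> t \<and> t \<le> T \<longrightarrow>
        (AE \<omega> in M.
           inner_L (\<lambda>\<theta>. u t \<theta> \<omega>) h =
             inner_L (\<lambda>\<theta>. u \<delta> \<theta> \<omega>) h
             - 1/2 * (LINT s|lebesgue_on {\<delta>..t}. inner_L (\<lambda>\<theta>. u s \<theta> \<omega>) A2h)
             - 1/2 * (LINT z:{\<delta><..t} \<times> {0..1}|\<eta> \<omega>. Ah (snd z))
             - wiener_integral M T W (\<lambda>(s, \<theta>). indicator {\<delta><..t} s * h' \<theta>) \<omega>)) \<and>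
     (AE \<omega> in M. (\<integral>\<^sup>+z. ennreal (u (fst z) (snd z) \<omega>) \<partial>\<eta> \<omega>) = 0)"

end

theory Submission
  imports Defs
begin

text \<open>
  The noise is the same for both solutions, so it disappears from the equation of the difference
  \<open>v = u1 - u2\<close>, and for almost every path one is left with the deterministic equation
  \<open>\<partial>\<^sub>t v = - A (A v + \<eta>1 - \<eta>2) / 2\<close>.  It is tested with the Neumann eigenfunctions
  \<open>e\<^sub>k = cos (k\<pi>x)\<close> of \<open>A\<close> and at rational times only, which costs countably many null sets.

  The mean of \<open>v\<close> is conserved and vanishes initially.  Formally, pairing with \<open>(-A)\<^sup>-\<^sup>1 v\<close> yields
  \<open>d \<parallel>v\<parallel>\<^sub>H\<^sup>2 \<le> \<integral> v d(\<eta>1 - \<eta>2)\<close>.  The right-hand side is not positive: by the contact conditions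
  \<open>v = - u2 \<le> 0\<close> on the support of \<open>\<eta>1\<close> and \<open>v = u1 \<ge> 0\<close> on that of \<open>\<eta>2\<close> (\<open>contact_sign\<close>).
  Hence the norm decreases, and since it tends to \<open>0\<close> at the initial time, \<open>v = 0\<close>.

  To justify this, each coefficient is treated separately: \<open>mode_energy\<close> is the chain rule for its
  square, proved with Riemann-Stieltjes sums.  The modes are then summed with Fejer weights.  The
  measures may be singular, so the regularized \<open>v\<close> has to converge at every point, with
  a uniform bound; Fejer means do this because their kernel is positive (\<open>fejer_kernel_nonneg\<close>,
  \<open>fejer_mean_tendsto\<close>).  The measures are finite away from time \<open>0\<close> but possibly not up to
  \<open>0\<close>, and the initial datum is attained in \<open>H\<close> only; the link is \<open>norm_H_lower_bound\<close>, which
  controls the truncated energies uniformly by the norm of \<open>H\<close>.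

  Knowing \<open>u1 = u2\<close>, the equation reduces to the statement that \<open>\<eta>1 - \<eta>2\<close> annihilates all functions
  of mean zero in space.  So it is \<open>c(dt) dx\<close> for some signed \<open>c\<close> (\<open>slab_difference\<close>), and integrating
  the common solution against it gives \<open>0 = (\<integral> u0 dx) c\<close> by the contact conditions and conservation
  of mass.  As the initial mass is positive, \<open>c = 0\<close> (\<open>excess_zero\<close>).
\<close>

section \<open>Integration on the unit interval\<close>

lemma integrable_01: "continuous_on {0..1} f \<Longrightarrow> integrable (lebesgue_on {0..1}) (f :: real \<Rightarrow> real)"
  by (rule continuous_imp_integrable_real)

lemma mean_cong: "(\<And>x. x \<in> {0..1} \<Longrightarrow> f x = g x) \<Longrightarrow> mean f = mean g"
  unfolding mean_def by (intro Bochner_Integration.integral_cong) auto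

lemma mean_mono:
  assumes "continuous_on {0..1} f" "continuous_on {0..1} g" "\<And>x. x \<in> {0..1} \<Longrightarrow> f x \<le> g x"
  shows "mean f \<le> mean g"
  unfolding mean_def by (intro integral_mono integrable_01 assms) (auto intro: assms)

lemma mean_const [simp]: "mean (\<lambda>x. c) = c"
  by (simp add: mean_def measure_restrict_space)

lemma mean_add:
  "continuous_on {0..1} f \<Longrightarrow> continuous_on {0..1} g \<Longrightarrow> mean (\<lambda>x. f x + g x) = mean f + mean g"
  unfolding mean_def by (intro Bochner_Integration.integral_add integrable_01)

lemma mean_diff:
  "continuous_on {0..1} f \<Longrightarrow> continuous_on {0..1} g \<Longrightarrow> mean (\<lambda>x. f x - g x) = mean f - mean g"
  unfolding mean_def by (intro Bochner_Integration.integral_diff integrable_01)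

lemma mean_cmult: "mean (\<lambda>x. c * f x) = c * mean f"
  unfolding mean_def by simp

lemma mean_sum:
  assumes "\<And>i. i \<in> I \<Longrightarrow> continuous_on {0..1} (f i)"
  shows "mean (\<lambda>x. \<Sum>i\<in>I. f i x) = (\<Sum>i\<in>I. mean (f i))"
  unfolding mean_def by (intro Bochner_Integration.integral_sum integrable_01 assms)

lemma interval_FTC:
  fixes F f :: "real \<Rightarrow> real"
  assumes "continuous_on {a..b} f" "a \<le> b"
    and "\<And>x. x \<in> {a..b} \<Longrightarrow> (F has_real_derivative f x) (at x within {a..b})"
  shows "(LINT x|lebesgue_on {a..b}. f x) = F b - F a"
proof -
  have "(f has_integral (F b - F a)) {a..b}"
    using assms by (intro fundamental_theorem_of_calculus)
      (auto simp: has_real_derivative_iff_has_vector_derivative)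
  then have "integral {a..b} f = F b - F a" by blast
  then show ?thesis
    using lebesgue_integral_eq_integral[OF continuous_imp_integrable_real[OF assms(1)]] by simp
qed

lemmas mean_FTC = interval_FTC[where a = 0 and b = 1, folded mean_def, simplified]

lemma mean_parts:
  assumes f: "\<And>x. x \<in> {0..1} \<Longrightarrow> (f has_real_derivative f' x) (at x within {0..1})"
    and g: "\<And>x. x \<in> {0..1} \<Longrightarrow> (g has_real_derivative g' x) (at x within {0..1})"
    and c: "continuous_on {0..1} f'" "continuous_on {0..1} g'"
  shows "mean (\<lambda>x. f' x * g x) = f 1 * g 1 - f 0 * g 0 - mean (\<lambda>x. f x * g' x)"
proof -
  have cf: "continuous_on {0..1} f" "continuous_on {0..1} g"
    by (auto simp: continuous_on_eq_continuous_within intro!: DERIV_continuous f g)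
  have "mean (\<lambda>x. f' x * g x + f x * g' x) = f 1 * g 1 - f 0 * g 0"
    by (rule mean_FTC) (auto intro!: continuous_intros c cf derivative_eq_intros f g)
  then show ?thesis
    by (subst (asm) mean_add) (auto intro!: continuous_intros c cf)
qed

text \<open>
  Test functions and resolvents have continuous derivatives throughout, so the Sobolev notion of
  derivative can be traded for the classical one.  This is the direction from calculus to Sobolev;
  \<open>H1_derivD\<close> is the way back.
\<close>

lemma H1_deriv_classical:
  assumes "continuous_on {0..1} g"
    and "\<And>x. x \<in> {0..1} \<Longrightarrow> (f has_real_derivative g x) (at x within {0..1})"
  shows "H1_deriv f g"
  unfolding H1_deriv_def L2_def
proof (intro conjI ballI)
  show "g \<in> borel_measurable (lebesgue_on {0..1})"
    using integrable_01[OF assms(1)] by auto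
  show "integrable (lebesgue_on {0..1}) (\<lambda>x. (g x)\<^sup>2)"
    by (intro integrable_01 continuous_intros assms)
  fix x :: real assume x: "x \<in> {0..1}"
  have "(LINT y|lebesgue_on {0..x}. g y) = f x - f 0"
    using x by (intro interval_FTC)
      (auto intro: continuous_on_subset[OF assms(1)] DERIV_subset[OF assms(2)])
  then show "f x = f 0 + (LINT y|lebesgue_on {0..x}. g y)" by simp
qed

lemma H1_deriv_integrable:
  assumes "H1_deriv f g" shows "integrable (lebesgue_on {0..1}) g"
proof -
  have "integrable (lebesgue_on {0..1}) (\<lambda>x. 1 + (g x)\<^sup>2)"
    using assms by (intro Bochner_Integration.integrable_add integrable_01[of "\<lambda>_. 1"])
      (auto simp: H1_deriv_def L2_def)
  then show ?thesis
  proof (rule Bochner_Integration.integrable_bound)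
    show "g \<in> borel_measurable (lebesgue_on {0..1})" using assms by (auto simp: H1_deriv_def L2_def)
    have "\<bar>y\<bar> \<le> 1 + y\<^sup>2" for y :: real
      using sum_squares_bound[of 1 "\<bar>y\<bar>"] by (simp add: field_simps)
    then show "AE x in lebesgue_on {0..1}. norm (g x) \<le> norm (1 + (g x)\<^sup>2)" by simp
  qed
qed

lemma H1_deriv_integral:
  assumes "H1_deriv f g" "y \<in> {0..1}"
  shows "f 0 + integral {0..y} g = f y"
proof -
  have "(LINT z|lebesgue_on {0..y}. g z) = integral {0..y} g"
    using assms by (intro lebesgue_integral_eq_integral
        integrable_subinterval[OF H1_deriv_integrable[OF assms(1)]]) auto
  moreover have "f y = f 0 + (LINT z|lebesgue_on {0..y}. g z)"
    using assms unfolding H1_deriv_def by (elim conjE) (rule bspec)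
  ultimately show ?thesis by simp
qed

lemma H1_deriv_continuous:
  assumes "H1_deriv f g" shows "continuous_on {0..1} f"
proof (rule continuous_on_eq)
  show "continuous_on {0..1} (\<lambda>x. f 0 + integral {0..x} g)"
    using integrable_on_lebesgue_on[OF H1_deriv_integrable[OF assms]]
    by (intro continuous_intros indefinite_integral_continuous_1) auto
qed (rule H1_deriv_integral[OF assms])

lemma H1_derivD:
  assumes "H1_deriv f g" "continuous_on {0..1} g" "x \<in> {0..1}"
  shows "(f has_real_derivative g x) (at x within {0..1})"
proof -
  have "((\<lambda>x. f 0 + integral {0..x} g) has_real_derivative g x) (at x within {0..1})"
    using integral_has_real_derivative[OF assms(2,3)] by (auto intro!: derivative_eq_intros)
  then show ?thesis
    unfolding has_field_derivative_def
    by (rule has_derivative_transform[OF assms(3), rotated]) (simp add: H1_deriv_integral[OF assms(1)])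
qed

section \<open>Cosine modes\<close>

definition cosmode :: "nat \<Rightarrow> real \<Rightarrow> real" where
  "cosmode k x = cos (real k * pi * x)"

definition eigenval :: "nat \<Rightarrow> real" where
  "eigenval k = (real k * pi)\<^sup>2"

lemma eigenval_pos: "k > 0 \<Longrightarrow> eigenval k > 0"
  by (simp add: eigenval_def)

lemma cosmode_0 [simp]: "cosmode 0 = (\<lambda>x. 1)"
  by (auto simp: cosmode_def)

lemma continuous_cosmode [continuous_intros]:
  fixes f :: "'a::t2_space \<Rightarrow> real"
  shows "continuous_on A f \<Longrightarrow> continuous_on A (\<lambda>x. cosmode k (f x))"
  unfolding cosmode_def by (intro continuous_intros)

text \<open>
  The cosines are the Neumann eigenfunctions of \<open>A\<close>, with \<open>A e\<^sub>k = - eigenval k \<cdot> e\<^sub>k\<close>; they are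
  the only test functions the uniqueness proof needs.
\<close>

lemma dom_A2_cosmode:
  "dom_A2 (cosmode k) (\<lambda>x. - (real k * pi * sin (real k * pi * x)))
     (\<lambda>x. - (eigenval k * cosmode k x)) (\<lambda>x. (eigenval k)\<^sup>2 * cosmode k x)"
proof -
  have [simp]: "sin (real k * pi) = 0" by (rule sin_npi)
  have "dom_A (\<lambda>x. - (eigenval k * cosmode k x)) (\<lambda>x. eigenval k * (real k * pi * sin (real k * pi * x)))
     (\<lambda>x. (eigenval k)\<^sup>2 * cosmode k x)"
    unfolding dom_A_def
    by (intro conjI H1_deriv_classical)
      (auto intro!: continuous_intros derivative_eq_intros simp: cosmode_def eigenval_def power2_eq_square)
  moreover have "dom_A (cosmode k) (\<lambda>x. - (real k * pi * sin (real k * pi * x)))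
     (\<lambda>x. - (eigenval k * cosmode k x))"
    unfolding dom_A_def
    by (intro conjI H1_deriv_classical)
      (auto intro!: continuous_intros derivative_eq_intros simp: cosmode_def[abs_def] eigenval_def power2_eq_square)
  ultimately show ?thesis unfolding dom_A2_def by blast
qed

lemma mean_cos:
  "mean (\<lambda>x. cos (of_int i * pi * x)) = (if i = 0 then 1 else 0)"
proof (cases "i = 0")
  case False
  have "mean (\<lambda>x. cos (of_int i * pi * x)) = sin (of_int i * pi * 1) / (of_int i * pi) - sin (of_int i * pi * 0) / (of_int i * pi)"
    by (rule mean_FTC) (use False in \<open>auto intro!: continuous_intros derivative_eq_intros\<close>)
  then show ?thesis using False sin_npi_int[of i] by (simp add: mult.commute)
qed simp

lemma mean_cos_times_cos:
  "mean (\<lambda>x. cosmode j x * cosmode k x) = (if j = k then if k = 0 then 1 else 1/2 else 0)"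
proof -
  have "mean (\<lambda>x. cosmode j x * cosmode k x) =
     mean (\<lambda>x. 1/2 * cos (of_int (int j - int k) * pi * x) + 1/2 * cos (of_int (int j + int k) * pi * x))"
    by (rule mean_cong) (simp add: cosmode_def cos_times_cos algebra_simps add_divide_distrib)
  also have "\<dots> = 1/2 * (if int j - int k = 0 then 1 else 0) + 1/2 * (if int j + int k = 0 then 1 else 0)"
    by (subst mean_add) (auto intro!: continuous_intros simp only: mean_cmult mean_cos)
  finally show ?thesis by auto
qed

lemma mean_sin_times_sin:
  assumes "j > 0" "k > 0"
  shows "mean (\<lambda>x. sin (real j * pi * x) * sin (real k * pi * x)) = (if j = k then 1/2 else 0)"
proof -
  have "mean (\<lambda>x. sin (real j * pi * x) * sin (real k * pi * x)) =
     mean (\<lambda>x. 1/2 * cos (of_int (int j - int k) * pi * x) - 1/2 * cos (of_int (int j + int k) * pi * x))"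
    by (rule mean_cong) (simp add: sin_times_sin algebra_simps diff_divide_distrib)
  also have "\<dots> = 1/2 * (if int j - int k = 0 then 1 else 0) - 1/2 * (if int j + int k = 0 then 1 else 0)"
    by (subst mean_diff) (auto intro!: continuous_intros simp only: mean_cmult mean_cos)
  finally show ?thesis using assms by auto
qed

section \<open>Fejer means of cosine series\<close>

definition fejer_weight :: "nat \<Rightarrow> nat \<Rightarrow> real" where
  "fejer_weight N k = 1 - real k / (real N + 1)"

text \<open>
  The Fejer kernel of the even functions of period \<open>2\<close>, in the cosine basis of \<open>[0,1]\<close>.
\<close>

definition fejer_kernel :: "nat \<Rightarrow> real \<Rightarrow> real \<Rightarrow> real" where
  "fejer_kernel N x y = 1 + 2 * (\<Sum>k=1..N. fejer_weight N k * cosmode k x * cosmode k y)"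

definition fejer_mean :: "nat \<Rightarrow> (real \<Rightarrow> real) \<Rightarrow> real \<Rightarrow> real" where
  "fejer_mean N f x = mean (\<lambda>y. fejer_kernel N x y * f y)"

lemma fejer_weight_bounds: "k \<le> N \<Longrightarrow> 0 \<le> fejer_weight N k" "fejer_weight N k \<le> 1"
  by (auto simp: fejer_weight_def)

lemma fejer_weight_tendsto: "(\<lambda>N. fejer_weight N k) \<longlonglongrightarrow> 1"
proof -
  have "(\<lambda>N. 1 - real k * inverse (real (Suc N))) \<longlonglongrightarrow> 1 - real k * 0"
    by (intro tendsto_intros LIMSEQ_inverse_real_of_nat)
  then show ?thesis by (simp add: fejer_weight_def[abs_def] divide_inverse add.commute)
qed

text \<open>
  Among the pairs of indices up to \<open>N\<close>, the difference \<open>k > 0\<close> occurs \<open>N + 1 - k\<close> times with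
  each sign.  This converts the triangular weights of the Fejer mean into a double sum, where
  positivity becomes visible.
\<close>

lemma sum_differences_even:
  fixes g :: "real \<Rightarrow> real"
  assumes even: "\<And>x. g (- x) = g x"
  shows "(\<Sum>j\<le>N. \<Sum>l\<le>N. g (real j - real l)) =
    (real N + 1) * g 0 + 2 * (\<Sum>k=1..N. (real N + 1 - real k) * g (real k))"
proof (induction N)
  case (Suc N)
  have reflect: "(\<Sum>j\<le>N. g (real (Suc N) - real j)) = (\<Sum>k=1..Suc N. g (real k))"
    by (rule sum.reindex_bij_witness[where i = "\<lambda>k. Suc N - k" and j = "\<lambda>j. Suc N - j"])
      (auto simp: of_nat_diff)
  have reflect': "(\<Sum>j\<le>N. g (real j - real (Suc N))) = (\<Sum>k=1..Suc N. g (real k))"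
    unfolding reflect[symmetric]
    by (intro sum.cong refl) (metis even minus_diff_eq)
  have "(\<Sum>j\<le>Suc N. \<Sum>l\<le>Suc N. g (real j - real l)) =
      (\<Sum>j\<le>N. \<Sum>l\<le>N. g (real j - real l)) + (\<Sum>j\<le>N. g (real j - real (Suc N)))
        + (\<Sum>l\<le>N. g (real (Suc N) - real l)) + g 0"
    by (simp add: sum.distrib)
  also have "\<dots> = (real N + 1) * g 0 + 2 * (\<Sum>k=1..N. (real N + 1 - real k) * g (real k))
      + 2 * (\<Sum>k=1..Suc N. g (real k)) + g 0"
    unfolding Suc.IH reflect reflect' by simp
  also have "(\<Sum>k=1..N. (real N + 1 - real k) * g (real k)) =
     (\<Sum>k=1..Suc N. (real N + 1 - real k) * g (real k))" by simp
  finally show ?case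
    by (simp add: sum.distrib[symmetric] sum_distrib_left algebra_simps)
qed simp

text \<open>
  Up to the factor \<open>N + 1\<close>, the kernel is a double sum of \<open>cos ((j - l)\<pi>x) cos ((j - l)\<pi>y)\<close>.  By
  the product formula it is the average of two sums of the form \<open>\<Sum>\<^sub>j\<^sub>l cos ((j - l) z)\<close>, and each of
  these is \<open>\<bar>\<Sum>\<^sub>j e\<^bsup>ijz\<^esup>\<bar>\<^sup>2\<close>, written below as a sum of two real squares.
\<close>

lemma fejer_kernel_nonneg: "0 \<le> fejer_kernel N x y"
proof -
  have square: "0 \<le> (\<Sum>j\<le>N. \<Sum>l\<le>N. cos ((real j - real l) * z))" for z
  proof -
    have "(\<Sum>j\<le>N. \<Sum>l\<le>N. cos ((real j - real l) * z)) =
      (\<Sum>j\<le>N. cos (real j * z))\<^sup>2 + (\<Sum>j\<le>N. sin (real j * z))\<^sup>2"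
      unfolding power2_eq_square sum_product
      by (simp add: left_diff_distrib cos_diff sum.distrib)
    then show ?thesis by simp
  qed
  have "(real N + 1) * fejer_kernel N x y = (real N + 1) * (cos (0 * pi * x) * cos (0 * pi * y)) +
     2 * (\<Sum>k=1..N. (real N + 1 - real k) * (cos (real k * pi * x) * cos (real k * pi * y)))"
    by (simp add: fejer_kernel_def fejer_weight_def cosmode_def distrib_left sum_distrib_left)
      (auto intro!: sum.cong simp: field_simps)
  also have "\<dots> = (\<Sum>j\<le>N. \<Sum>l\<le>N. cos ((real j - real l) * pi * x) * cos ((real j - real l) * pi * y))"
    by (rule sum_differences_even[symmetric]) simp
  also have "\<dots> = (\<Sum>j\<le>N. \<Sum>l\<le>N. (cos ((real j - real l) * (pi * x - pi * y)) +
      cos ((real j - real l) * (pi * x + pi * y))) / 2)"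
    unfolding cos_times_cos by (simp add: algebra_simps)
  also have "\<dots> \<ge> 0"
    unfolding sum_divide_distrib[symmetric] sum.distrib
    by (intro divide_nonneg_pos add_nonneg_nonneg square) auto
  finally show ?thesis by (simp add: zero_le_mult_iff)
qed

lemma continuous_fejer_kernel [continuous_intros]:
  "continuous_on A (\<lambda>y. fejer_kernel N x y)"
  unfolding fejer_kernel_def by (intro continuous_intros)

lemma fejer_mean_expansion:
  assumes "continuous_on {0..1} f"
  shows "fejer_mean N f x = mean f + 2 * (\<Sum>k=1..N. fejer_weight N k * inner_L f (cosmode k) * cosmode k x)"
proof -
  have "fejer_mean N f x = mean (\<lambda>y. f y + (\<Sum>k=1..N. (2 * fejer_weight N k * cosmode k x) * (f y * cosmode k y)))"
    unfolding fejer_mean_def fejer_kernel_def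
    by (rule mean_cong) (simp add: algebra_simps sum_distrib_left)
  also have "\<dots> = mean f + (\<Sum>k=1..N. (2 * fejer_weight N k * cosmode k x) * mean (\<lambda>y. f y * cosmode k y))"
    by (subst mean_add mean_sum, (intro continuous_intros assms)+)+ (simp only: mean_cmult)
  finally show ?thesis by (simp add: inner_L_def mean_def sum_distrib_left algebra_simps)
qed

lemma fejer_mean_mono:
  assumes "continuous_on {0..1} f" "continuous_on {0..1} g" "\<And>x. x \<in> {0..1} \<Longrightarrow> f x \<le> g x"
  shows "fejer_mean N f x \<le> fejer_mean N g x"
  unfolding fejer_mean_def
  by (rule mean_mono) (auto intro!: continuous_intros assms mult_left_mono fejer_kernel_nonneg)

lemma fejer_mean_const: "fejer_mean N (\<lambda>x. c) x = c"
proof -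
  have "inner_L (\<lambda>x. c) (cosmode k) = 0" if "k > 0" for k
    using mean_cos_times_cos[of 0 k] that by (simp add: inner_L_def mean_def)
  then show ?thesis by (subst fejer_mean_expansion) auto
qed

lemma fejer_mean_add:
  assumes "continuous_on {0..1} f" "continuous_on {0..1} g"
  shows "fejer_mean N (\<lambda>x. f x + g x) x = fejer_mean N f x + fejer_mean N g x"
  unfolding fejer_mean_def distrib_left
  by (rule mean_add) (auto intro!: continuous_intros assms)

lemma fejer_mean_cmult: "fejer_mean N (\<lambda>x. c * f x) x = c * fejer_mean N f x"
  unfolding fejer_mean_def by (simp flip: mean_cmult add: algebra_simps)

lemma fejer_mean_abs_le:
  assumes "continuous_on {0..1} f" "\<And>x. x \<in> {0..1} \<Longrightarrow> \<bar>f x\<bar> \<le> B"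
  shows "\<bar>fejer_mean N f x\<bar> \<le> B"
proof -
  have "f y \<le> B" "- B \<le> f y" if "y \<in> {0..1}" for y
    using assms(2)[OF that] by auto
  then show ?thesis
    using fejer_mean_mono[of f "\<lambda>_. B" N x] fejer_mean_mono[of "\<lambda>_. - B" f N x] assms
    by (auto simp: fejer_mean_const)
qed

lemma fejer_mean_cosmode_tendsto: "(\<lambda>N. fejer_mean N (cosmode j) x) \<longlonglongrightarrow> cosmode j x"
proof (cases "j = 0")
  case True then show ?thesis by (simp add: fejer_mean_const)
next
  case False
  have "fejer_mean N (cosmode j) x = fejer_weight N j * cosmode j x" if "N \<ge> j" for N
  proof -
    have "inner_L (cosmode j) (cosmode k) = (if j = k then 1/2 else 0)" for k
      using mean_cos_times_cos[of j k] False by (auto simp: inner_L_def mean_def)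
    moreover have "mean (cosmode j) = 0"
      using mean_cos_times_cos[of j 0] False by simp
    ultimately have "fejer_mean N (cosmode j) x =
        2 * (\<Sum>k=1..N. if j = k then fejer_weight N j / 2 * cosmode j x else 0)"
      by (subst fejer_mean_expansion)
         (auto intro!: continuous_intros sum.cong simp del: sum.delta sum.delta')
    then show ?thesis using False that by simp
  qed
  then have "\<forall>\<^sub>F N in sequentially. fejer_weight N j * cosmode j x = fejer_mean N (cosmode j) x"
    by (auto simp: eventually_sequentially intro!: exI[of _ j])
  moreover have "(\<lambda>N. fejer_weight N j * cosmode j x) \<longlonglongrightarrow> 1 * cosmode j x"
    by (intro tendsto_intros fejer_weight_tendsto)
  ultimately show ?thesis by (simp add: tendsto_cong[symmetric])
qed

text \<open>
  A Korovkin argument.  The Fejer means are positive operators that fix constants, and on cosines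
  they converge.  For fixed \<open>x\<close> the oscillation \<open>\<bar>f y - f x\<bar>\<close> is at most \<open>e/2 + C q(y)\<close> with
  \<open>q(y) = (cos \<pi>y - cos \<pi>x)\<^sup>2\<close>, because the cosine is injective on \<open>[0, \<pi>]\<close>.  Since \<open>q\<close> is a
  combination of the modes \<open>0, 1, 2\<close> and vanishes at \<open>x\<close>, its means at \<open>x\<close> tend to \<open>0\<close>.
\<close>

theorem fejer_mean_tendsto:
  assumes f: "continuous_on {0..1} f" and x: "x \<in> {0..1}"
  shows "(\<lambda>N. fejer_mean N f x) \<longlonglongrightarrow> f x"
proof -
  define q where "q y = (cosmode 1 y - cosmode 1 x)\<^sup>2" for y
  have q: "continuous_on {0..1} q"
    unfolding q_def by (intro continuous_intros)
  have q_eq: "q = (\<lambda>y. (1/2 + (cosmode 1 x)\<^sup>2) + (1/2 * cosmode 2 y + (- 2 * cosmode 1 x) * cosmode 1 y))"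
  proof
    fix y
    have "cosmode 2 y = 2 * (cosmode 1 y)\<^sup>2 - 1"
      using cos_double_cos[of "pi * y"] by (simp add: cosmode_def mult.assoc)
    then show "q y = (1/2 + (cosmode 1 x)\<^sup>2) + (1/2 * cosmode 2 y + (- 2 * cosmode 1 x) * cosmode 1 y)"
      by (simp add: q_def power2_eq_square algebra_simps)
  qed
  have Pq_eq: "fejer_mean N q x = (1/2 + (cosmode 1 x)\<^sup>2) +
     (1/2 * fejer_mean N (cosmode 2) x + (- 2 * cosmode 1 x) * fejer_mean N (cosmode 1) x)" for N
    unfolding q_eq
    by (subst fejer_mean_add, (intro continuous_intros)+)+ (simp only: fejer_mean_cmult fejer_mean_const)
  have "(\<lambda>N. fejer_mean N q x) \<longlonglongrightarrow> (1/2 + (cosmode 1 x)\<^sup>2) +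
     (1/2 * cosmode 2 x + (- 2 * cosmode 1 x) * cosmode 1 x)"
    unfolding Pq_eq by (intro tendsto_intros fejer_mean_cosmode_tendsto)
  then have Pq: "(\<lambda>N. fejer_mean N q x) \<longlonglongrightarrow> 0"
    using fun_cong[OF q_eq, of x] by (simp add: q_def)
  show ?thesis
  proof (rule LIMSEQ_I)
    fix e :: real assume e: "e > 0"
    have "\<exists>C\<ge>0. \<forall>y\<in>{0..1}. \<bar>f y - f x\<bar> \<le> e/2 + C * q y"
    proof -
      define S where "S = {y\<in>{0..1}. e/2 \<le> \<bar>f y - f x\<bar>}"
      have S: "compact S"
      proof -
        have "closed S"
          unfolding S_def by (intro continuous_closed_preimage_constant continuous_on_closed_Collect_le
              continuous_intros f closed_atLeastAtMost)
        moreover have "S \<subseteq> {0..1}" by (auto simp: S_def)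
        ultimately show ?thesis
          using compact_Int_closed[OF compact_Icc] by (metis inf.absorb_iff2)
      qed
      show ?thesis
      proof (cases "S = {}")
        case True
        then show ?thesis by (intro exI[of _ 0]) (auto simp: S_def)
      next
        case False
        have Ssub: "S \<subseteq> {0..1}" by (auto simp: S_def)
        obtain y0 where y0: "y0 \<in> S" "\<And>y. y \<in> S \<Longrightarrow> q y0 \<le> q y"
          using continuous_attains_inf[OF S False continuous_on_subset[OF q Ssub]] by blast
        have "q y0 > 0"
        proof -
          have "y0 \<noteq> x" using y0(1) e by (auto simp: S_def)
          then have "cosmode 1 y0 \<noteq> cosmode 1 x"
            using y0(1) Ssub x cos_inj_pi[of "pi * y0" "pi * x"] by (auto simp: cosmode_def)
          then show ?thesis by (simp add: q_def)
        qed
        obtain B where B: "\<And>y. y \<in> {0..1} \<Longrightarrow> \<bar>f y\<bar> \<le> B"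
          using compact_imp_bounded[OF compact_continuous_image[OF f compact_Icc]]
          unfolding bounded_iff by (metis imageI real_norm_def)
        have B0: "B \<ge> 0" using B[OF x] by simp
        \<comment> \<open>Where the oscillation exceeds \<open>e/2\<close> it is at most \<open>2 B\<close>, while \<open>q\<close> is at least \<open>q y0 > 0\<close>.\<close>
        show ?thesis
        proof (intro exI[of _ "2 * B / q y0"] conjI ballI)
          show "0 \<le> 2 * B / q y0" using \<open>q y0 > 0\<close> B0 by simp
          fix y :: real assume y: "y \<in> {0..1}"
          show "\<bar>f y - f x\<bar> \<le> e/2 + 2 * B / q y0 * q y"
          proof (cases "y \<in> S")
            case True
            have "\<bar>f y - f x\<bar> \<le> 2 * B" using B[OF x] B[OF y] by simp
            also have "\<dots> = 2 * B / q y0 * q y0" using \<open>q y0 > 0\<close> by simp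
            also have "\<dots> \<le> 2 * B / q y0 * q y"
              using \<open>q y0 > 0\<close> B0 y0(2)[OF True] by (intro mult_left_mono) auto
            finally show ?thesis using e by simp
          next
            case False
            then have "\<bar>f y - f x\<bar> \<le> e/2" using y by (auto simp: S_def)
            moreover have "0 \<le> 2 * B / q y0 * q y" using \<open>q y0 > 0\<close> B0 by (simp add: q_def)
            ultimately show ?thesis by simp
          qed
        qed
      qed
    qed
    then obtain C where C: "C \<ge> 0" "\<And>y. y \<in> {0..1} \<Longrightarrow> \<bar>f y - f x\<bar> \<le> e/2 + C * q y" by blast
    have bound: "\<bar>fejer_mean N f x - f x\<bar> \<le> e/2 + C * fejer_mean N q x" for N
    proof -
      have up: "fejer_mean N f x \<le> fejer_mean N (\<lambda>y. (f x + e/2) + C * q y) x"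
        by (rule fejer_mean_mono) (use C(2) in \<open>auto intro!: continuous_intros f q simp: abs_le_iff algebra_simps\<close>)
      have lo: "fejer_mean N (\<lambda>y. (f x - e/2) + (- C) * q y) x \<le> fejer_mean N f x"
        by (rule fejer_mean_mono) (use C(2) in \<open>auto intro!: continuous_intros f q simp: abs_le_iff algebra_simps\<close>)
      have lin: "fejer_mean N (\<lambda>y. c + d * q y) x = c + d * fejer_mean N q x" for c d
        by (subst fejer_mean_add) (auto intro!: continuous_intros q simp: fejer_mean_const fejer_mean_cmult)
      show ?thesis using up lo unfolding lin by (simp add: abs_le_iff)
    qed
    have "(\<lambda>N. C * fejer_mean N q x) \<longlonglongrightarrow> C * 0" by (intro tendsto_intros Pq)
    from order_tendstoD(2)[OF this, of "e/2"] e
    obtain n0 where "\<And>N. N \<ge> n0 \<Longrightarrow> C * fejer_mean N q x < e/2"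
      by (auto simp: eventually_sequentially)
    then have "\<And>N. N \<ge> n0 \<Longrightarrow> norm (fejer_mean N f x - f x) < e"
      using bound by (smt (verit, best) real_norm_def field_sum_of_halves)
    then show "\<exists>n0. \<forall>N\<ge>n0. norm (fejer_mean N f x - f x) < e" by blast
  qed
qed

section \<open>A lower bound for the dual norm\<close>

lemma bessel_sine:
  assumes p: "continuous_on {0..1} p"
  shows "(\<Sum>k=1..K. 2 * (mean (\<lambda>x. p x * sin (real k * pi * x)))\<^sup>2) \<le> mean (\<lambda>x. (p x)\<^sup>2)"
proof -
  define s where "s k x = sin (real k * pi * x)" for k x
  define c where "c k = mean (\<lambda>x. p x * s k x)" for k
  define S where "S x = (\<Sum>k=1..K. 2 * c k * s k x)" for x
  have s: "continuous_on {0..1} (s k)" for k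
    unfolding s_def by (intro continuous_intros)
  have S: "continuous_on {0..1} S"
    unfolding S_def by (intro continuous_intros s)
  have pS: "mean (\<lambda>x. p x * S x) = (\<Sum>k=1..K. 2 * (c k)\<^sup>2)"
  proof -
    have "mean (\<lambda>x. p x * S x) = mean (\<lambda>x. \<Sum>k=1..K. 2 * c k * (p x * s k x))"
      by (rule mean_cong) (simp add: S_def sum_distrib_left algebra_simps)
    also have "\<dots> = (\<Sum>k=1..K. 2 * c k * c k)"
      by (subst mean_sum) (auto intro!: continuous_intros p s simp: mean_cmult c_def)
    finally show ?thesis by (simp add: power2_eq_square algebra_simps)
  qed
  have sS: "mean (\<lambda>x. s k x * S x) = c k" if "k \<in> {1..K}" for k
  proof -
    have "mean (\<lambda>x. s k x * S x) = mean (\<lambda>x. \<Sum>j=1..K. 2 * c j * (s k x * s j x))"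
      by (rule mean_cong) (simp add: S_def sum_distrib_left algebra_simps)
    also have "\<dots> = (\<Sum>j=1..K. 2 * c j * mean (\<lambda>x. s k x * s j x))"
      by (subst mean_sum) (auto intro!: continuous_intros s simp: mean_cmult)
    also have "\<dots> = (\<Sum>j=1..K. if k = j then c j else 0)"
      using that by (intro sum.cong) (auto simp: s_def mean_sin_times_sin)
    finally show ?thesis using that by simp
  qed
  have SS: "mean (\<lambda>x. S x * S x) = (\<Sum>k=1..K. 2 * (c k)\<^sup>2)"
  proof -
    have "mean (\<lambda>x. S x * S x) = mean (\<lambda>x. \<Sum>k=1..K. 2 * c k * (s k x * S x))"
      by (rule mean_cong) (simp add: S_def sum_distrib_right algebra_simps)
    also have "\<dots> = (\<Sum>k=1..K. 2 * c k * mean (\<lambda>x. s k x * S x))"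
      by (subst mean_sum) (auto intro!: continuous_intros s S simp: mean_cmult)
    also have "\<dots> = (\<Sum>k=1..K. 2 * c k * c k)"
      by (intro sum.cong) (auto simp: sS)
    finally show ?thesis by (simp add: power2_eq_square algebra_simps)
  qed
  have "0 \<le> mean (\<lambda>x. (p x - S x)\<^sup>2)"
    using mean_mono[of "\<lambda>_. 0" "\<lambda>x. (p x - S x)\<^sup>2"] by (simp add: continuous_intros p S)
  also have "mean (\<lambda>x. (p x - S x)\<^sup>2) = mean (\<lambda>x. ((p x)\<^sup>2 - 2 * (p x * S x)) + S x * S x)"
    by (rule mean_cong) (simp add: power2_eq_square algebra_simps)
  also have "\<dots> = mean (\<lambda>x. (p x)\<^sup>2) - 2 * mean (\<lambda>x. p x * S x) + mean (\<lambda>x. S x * S x)"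
    by (subst mean_add mean_diff, (intro continuous_intros p S)+)+ (simp only: mean_cmult)
  finally show ?thesis unfolding pS SS by (simp add: c_def s_def)
qed

text \<open>
  The description operator behind \<open>inv_minus_A\<close> has a solution to choose: integrate \<open>f\<close> twice.
  The Neumann condition at \<open>1\<close> is exactly the vanishing of the mean of \<open>f\<close>.
\<close>

lemma ex_inv_minus_A:
  assumes f: "continuous_on {0..1} f" and m: "mean f = 0"
  shows "\<exists>g. (\<exists>g'. dom_A g g' (\<lambda>x. - f x)) \<and> mean g = 0"
proof -
  define g1 where "g1 x = - integral {0..x} f" for x
  define g2 where "g2 x = integral {0..x} g1" for x
  have d1: "(g1 has_real_derivative - f x) (at x within {0..1})" if "x \<in> {0..1}" for x
    unfolding g1_def using integral_has_real_derivative[OF f that] by (auto intro!: derivative_eq_intros)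
  then have c1: "continuous_on {0..1} g1"
    by (rule DERIV_continuous_on)
  have d2: "(g2 has_real_derivative g1 x) (at x within {0..1})" if "x \<in> {0..1}" for x
    unfolding g2_def using integral_has_real_derivative[OF c1 that] by (auto intro!: derivative_eq_intros)
  then have c2: "continuous_on {0..1} g2"
    by (rule DERIV_continuous_on)
  have "g1 1 = 0"
    using m lebesgue_integral_eq_integral[OF integrable_01[OF f]] by (simp add: g1_def mean_def)
  moreover have "g1 0 = 0" by (simp add: g1_def)
  ultimately have "dom_A (\<lambda>x. g2 x - mean g2) g1 (\<lambda>x. - f x)"
    unfolding dom_A_def
    by (intro conjI H1_deriv_classical) (auto intro!: continuous_intros c1 d1 f derivative_eq_intros d2)
  moreover have "mean (\<lambda>x. g2 x - mean g2) = 0"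
    by (subst mean_diff) (auto intro!: continuous_intros c2)
  ultimately show ?thesis by blast
qed

text \<open>
  With \<open>g = (-A)\<^sup>-\<^sup>1 (f - mean f)\<close>, an integration by parts gives
  \<open>(f, f)\<^sub>H = \<integral> g'\<^sup>2 + (mean f)\<^sup>2\<close>.  Another one turns the \<open>k\<close>-th cosine coefficient of \<open>f\<close> into
  \<open>- k\<pi>\<close> times the \<open>k\<close>-th sine coefficient of \<open>g'\<close>, so that the sum on the left is controlled by
  Bessel's inequality for \<open>g'\<close>.  The bound is uniform in \<open>K\<close>; this is what allows the initial time
  to be approached in the norm of \<open>H\<close> only.
\<close>

theorem norm_H_lower_bound:
  assumes f: "continuous_on {0..1} f"
  shows "(mean f)\<^sup>2 + (\<Sum>k=1..K. 2 * (inner_L f (cosmode k))\<^sup>2 / eigenval k) \<le> (norm_H f)\<^sup>2"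
proof -
  define f0 where "f0 x = f x - mean f" for x
  have f0: "continuous_on {0..1} f0" unfolding f0_def by (intro continuous_intros f)
  have m0: "mean f0 = 0" unfolding f0_def by (subst mean_diff) (auto intro!: continuous_intros f)
  define g where "g = inv_minus_A f0"
  have "(\<exists>g'. dom_A g g' (\<lambda>x. - f0 x)) \<and> mean g = 0"
    unfolding g_def inv_minus_A_def by (rule someI_ex[OF ex_inv_minus_A[OF f0 m0]])
  then obtain g' where dom: "dom_A g g' (\<lambda>x. - f0 x)" and mg: "mean g = 0" by blast
  have cg': "continuous_on {0..1} g'" and cg: "continuous_on {0..1} g"
    using dom by (auto simp: dom_A_def intro: H1_deriv_continuous)
  have dg: "(g has_real_derivative g' x) (at x within {0..1})" if "x \<in> {0..1}" for x
    using dom that by (intro H1_derivD cg') (auto simp: dom_A_def)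
  have dg': "(g' has_real_derivative - f0 x) (at x within {0..1})" if "x \<in> {0..1}" for x
    using dom that by (intro H1_derivD continuous_intros f0) (auto simp: dom_A_def)
  have bd: "g' 0 = 0" "g' 1 = 0" using dom by (auto simp: dom_A_def)
  have parts: "mean (\<lambda>x. f0 x * p x) = mean (\<lambda>x. g' x * p' x)"
    if "\<And>x. x \<in> {0..1} \<Longrightarrow> (p has_real_derivative p' x) (at x within {0..1})"
      "continuous_on {0..1} p'" for p p'
  proof -
    have "mean (\<lambda>x. - f0 x * p x) = - mean (\<lambda>x. g' x * p' x)"
      using mean_parts[OF dg' that(1) _ that(2)] bd by (simp add: continuous_intros f0)
    then show ?thesis using mean_cmult[of "-1" "\<lambda>x. f0 x * p x"] by simp
  qed
  have "inner_H f f = mean (\<lambda>x. (g x + mean f) * f x)"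
    by (simp add: inner_H_def inner_L_def mean_def Qbar_def g_def f0_def[abs_def])
  also have "\<dots> = mean (\<lambda>x. (f0 x * g x + mean f * g x) + mean f * f x)"
    by (rule mean_cong) (simp add: f0_def algebra_simps)
  also have "\<dots> = mean (\<lambda>x. f0 x * g x) + (mean f)\<^sup>2"
    by (subst mean_add, (intro continuous_intros f f0 cg)+)+ (simp add: mean_cmult mg power2_eq_square)
  also have "mean (\<lambda>x. f0 x * g x) = mean (\<lambda>x. (g' x)\<^sup>2)"
    using parts[OF dg cg'] by (simp add: power2_eq_square)
  finally have inner: "inner_H f f = mean (\<lambda>x. (g' x)\<^sup>2) + (mean f)\<^sup>2" .
  have coeff: "(inner_L f (cosmode k))\<^sup>2 / eigenval k = (mean (\<lambda>x. g' x * sin (real k * pi * x)))\<^sup>2"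
    if k: "k > 0" for k
  proof -
    have "inner_L f (cosmode k) = mean (\<lambda>x. f0 x * cosmode k x + mean f * cosmode k x)"
      unfolding inner_L_def mean_def[symmetric] by (rule mean_cong) (simp add: f0_def algebra_simps)
    also have "\<dots> = mean (\<lambda>x. f0 x * cosmode k x)"
      using mean_cos_times_cos[of k 0] k
      by (subst mean_add) (auto intro!: continuous_intros f0 simp: mean_cmult)
    also have "\<dots> = mean (\<lambda>x. g' x * - (real k * pi * sin (real k * pi * x)))"
      by (rule parts) (auto intro!: continuous_intros derivative_eq_intros simp: cosmode_def[abs_def])
    also have "\<dots> = - (real k * pi) * mean (\<lambda>x. g' x * sin (real k * pi * x))"
      by (subst mean_cmult[symmetric]) (simp add: algebra_simps)
    finally show ?thesis
      using k by (simp add: eigenval_def power_mult_distrib)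
  qed
  have "(\<Sum>k=1..K. 2 * (inner_L f (cosmode k))\<^sup>2 / eigenval k) =
      (\<Sum>k=1..K. 2 * (mean (\<lambda>x. g' x * sin (real k * pi * x)))\<^sup>2)"
    by (intro sum.cong refl) (simp add: coeff flip: times_divide_eq_right)
  also have "\<dots> \<le> mean (\<lambda>x. (g' x)\<^sup>2)" by (rule bessel_sine[OF cg'])
  finally have le: "(mean f)\<^sup>2 + (\<Sum>k=1..K. 2 * (inner_L f (cosmode k))\<^sup>2 / eigenval k) \<le> inner_H f f"
    using inner by simp
  have "0 \<le> mean (\<lambda>x. (g' x)\<^sup>2)"
    using mean_mono[of "\<lambda>_. 0" "\<lambda>x. (g' x)\<^sup>2"] by (simp add: continuous_intros cg')
  then have "0 \<le> inner_H f f" by (simp add: inner)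
  then show ?thesis using le by (simp add: norm_H_def)
qed

section \<open>Riemann--Stieltjes sums\<close>

definition grid :: "real \<Rightarrow> real \<Rightarrow> nat \<Rightarrow> nat \<Rightarrow> real" where
  "grid s t n i = s + (t - s) * (real i / real (Suc n))"

lemma grid_0 [simp]: "grid s t n 0 = s"
  and grid_last [simp]: "grid s t n (Suc n) = t"
  by (simp_all add: grid_def del: of_nat_Suc)

lemma grid_mono: "s \<le> t \<Longrightarrow> i \<le> j \<Longrightarrow> grid s t n i \<le> grid s t n j"
  by (auto simp: grid_def intro!: mult_left_mono divide_right_mono)

lemma grid_bounds: "s \<le> t \<Longrightarrow> i \<le> Suc n \<Longrightarrow> s \<le> grid s t n i" "s \<le> t \<Longrightarrow> i \<le> Suc n \<Longrightarrow> grid s t n i \<le> t"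
  using grid_mono[of s t 0 i n] grid_mono[of s t i "Suc n" n] by auto

lemma grid_step: "grid s t n (Suc i) = grid s t n i + (t - s) / real (Suc n)"
  unfolding grid_def of_nat_Suc[of i] add_divide_distrib distrib_left by simp

lemma grid_cell:
  assumes "s < r" "r \<le> t"
  shows "\<exists>i<Suc n. grid s t n i < r \<and> r \<le> grid s t n (Suc i)"
proof -
  define i where "i = (LEAST j. r \<le> grid s t n j)"
  have ex: "r \<le> grid s t n (Suc n)" using assms by simp
  have i1: "r \<le> grid s t n i" unfolding i_def by (rule LeastI[of "\<lambda>j. r \<le> grid s t n j", OF ex])
  have i2: "i \<le> Suc n" unfolding i_def by (rule Least_le[of "\<lambda>j. r \<le> grid s t n j", OF ex])
  have "i \<noteq> 0" using i1 assms(1) by (metis grid_0 leD)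
  then obtain j where j: "i = Suc j" by (cases i) auto
  have "\<not> r \<le> grid s t n j" using j not_less_Least[of j "\<lambda>j. r \<le> grid s t n j"] by (simp add: i_def)
  then show ?thesis using i1 i2 j by (intro exI[of _ j]) auto
qed

lemma sum_indicator_cells:
  assumes "s \<le> t" "j < Suc n" "grid s t n j < r" "r \<le> grid s t n (Suc j)"
  shows "(\<Sum>i<Suc n. indicator {grid s t n i<..grid s t n (Suc i)} r * h i) = (h j :: real)"
proof -
  have "indicator {grid s t n i<..grid s t n (Suc i)} r = (if i = j then 1 else 0 :: real)" for i
  proof (cases i j rule: linorder_cases)
    case less
    then have "grid s t n (Suc i) \<le> grid s t n j" using assms(1) by (intro grid_mono) auto
    then show ?thesis using less assms by auto
  next
    case greater
    then have "grid s t n (Suc j) \<le> grid s t n i" using assms(1) by (intro grid_mono) auto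
    then show ?thesis using greater assms by auto
  qed (use assms in auto)
  then show ?thesis using assms(2) by (simp add: if_distrib[of "\<lambda>x. x * _"] del: sum.lessThan_Suc cong: if_cong)
qed

text \<open>
  Cell by cell, the time argument of \<open>g\<close> is frozen at the right end of the cell.  The sum is the
  integral of a function that agrees with \<open>g\<close> at a time at most one mesh size away, so dominated
  convergence applies.  This lemma replaces the chain rule for paths of bounded variation, and it
  extends identities from functions of the space variable to functions of both variables.  The
  time coordinate \<open>\<tau>\<close> is kept abstract because both the strip measures and Lebesgue measure in
  time are needed.
\<close>

theorem riemann_stieltjes_tendsto:
  fixes \<nu> :: "'b measure" and \<tau> :: "'b \<Rightarrow> real" and g :: "real \<Rightarrow> 'b \<Rightarrow> real"
  assumes "s < t"
    and [measurable]: "\<tau> \<in> borel_measurable \<nu>"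
    and fin: "emeasure \<nu> {z\<in>space \<nu>. \<tau> z \<in> {s<..t}} < \<infinity>"
    and meas: "\<And>r. r \<in> {s..t} \<Longrightarrow> g r \<in> borel_measurable \<nu>"
    and cont: "\<And>z. z \<in> space \<nu> \<Longrightarrow> \<tau> z \<in> {s<..t} \<Longrightarrow> continuous_on {s..t} (\<lambda>r. g r z)"
    and bound: "\<And>z r. z \<in> space \<nu> \<Longrightarrow> \<tau> z \<in> {s<..t} \<Longrightarrow> r \<in> {s..t} \<Longrightarrow> \<bar>g r z\<bar> \<le> B"
  shows "(\<lambda>n. \<Sum>i<Suc n. LINT z|\<nu>. indicator {grid s t n i<..grid s t n (Suc i)} (\<tau> z) * g (grid s t n (Suc i)) z)
    \<longlonglongrightarrow> (LINT z|\<nu>. indicator {s<..t} (\<tau> z) * g (\<tau> z) z)"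
proof -
  define S where "S n z = (\<Sum>i<Suc n. indicator {grid s t n i<..grid s t n (Suc i)} (\<tau> z) * g (grid s t n (Suc i)) z)" for n z
  define w where "w z = B * indicator {s<..t} (\<tau> z)" for z
  have grid_in: "grid s t n i \<in> {s..t}" if "i \<le> Suc n" for n i
    using grid_bounds[of s t i n] \<open>s < t\<close> that by auto
  have S_out: "indicator {grid s t n i<..grid s t n (Suc i)} (\<tau> z) = (0::real)"
    if "\<tau> z \<notin> {s<..t}" "i < Suc n" for n i z
    using that grid_in[of i n] grid_in[of "Suc i" n] by (auto simp: indicator_def)
  have S_in: "\<exists>q\<in>{s..t}. S n z = g q z \<and> \<bar>q - \<tau> z\<bar> \<le> (t - s) / real (Suc n)"
    if "\<tau> z \<in> {s<..t}" for n z
  proof -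
    have "s < \<tau> z" "\<tau> z \<le> t" using that by auto
    from grid_cell[OF this, of n] obtain j where j: "j < Suc n" "grid s t n j < \<tau> z" "\<tau> z \<le> grid s t n (Suc j)"
      by blast
    have "S n z = g (grid s t n (Suc j)) z"
      unfolding S_def using \<open>s < t\<close> by (intro sum_indicator_cells j) auto
    moreover have "\<bar>grid s t n (Suc j) - \<tau> z\<bar> \<le> (t - s) / real (Suc n)"
      using j grid_step[of s t n j] by simp
    ultimately show ?thesis using grid_in[of "Suc j" n] j(1) by (intro bexI[of _ "grid s t n (Suc j)"]) auto
  qed
  have w_int: "integrable \<nu> w"
  proof -
    have "integrable \<nu> (indicator {z\<in>space \<nu>. \<tau> z \<in> {s<..t}} :: _ \<Rightarrow> real)"
      using fin by (intro integrable_real_indicator) auto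
    then have "integrable \<nu> (\<lambda>z. B * indicator {z\<in>space \<nu>. \<tau> z \<in> {s<..t}} z)" by simp
    then show ?thesis
      by (rule Bochner_Integration.integrable_cong[THEN iffD1, rotated -1])
        (auto simp: w_def indicator_def)
  qed
  have S_meas: "S n \<in> borel_measurable \<nu>" for n
    unfolding S_def by (intro borel_measurable_sum borel_measurable_times meas grid_in) auto
  have S_bound: "\<bar>S n z\<bar> \<le> w z" if "z \<in> space \<nu>" for n z
  proof (cases "\<tau> z \<in> {s<..t}")
    case True then show ?thesis using S_in[OF True, of n] bound[OF that True] by (auto simp: w_def)
  next
    case False then show ?thesis by (simp add: S_def S_out w_def del: sum.lessThan_Suc)
  qed
  have S_lim: "(\<lambda>n. S n z) \<longlonglongrightarrow> indicator {s<..t} (\<tau> z) * g (\<tau> z) z" if z: "z \<in> space \<nu>" for z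
  proof (cases "\<tau> z \<in> {s<..t}")
    case True
    obtain q where q: "\<And>n. q n \<in> {s..t}" "\<And>n. S n z = g (q n) z"
        "\<And>n. \<bar>q n - \<tau> z\<bar> \<le> (t - s) / real (Suc n)"
      using S_in[OF True] by metis
    have "q \<longlonglongrightarrow> \<tau> z"
    proof (rule Lim_null_comparison[THEN LIM_zero_cancel])
      show "\<forall>\<^sub>F n in sequentially. norm (q n - \<tau> z) \<le> (t - s) * inverse (real (Suc n))"
        using q(3) by (simp add: divide_inverse del: of_nat_Suc)
      show "(\<lambda>n. (t - s) * inverse (real (Suc n))) \<longlonglongrightarrow> 0"
        using tendsto_mult[OF tendsto_const LIMSEQ_inverse_real_of_nat, of "t - s"] by simp
    qed
    then have "(\<lambda>n. g (q n) z) \<longlonglongrightarrow> g (\<tau> z) z"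
      using q(1) True by (intro continuous_on_tendsto_compose[OF cont[OF z True]]) auto
    then show ?thesis using True by (simp add: q(2))
  next
    case False
    then have "S n z = 0" for n by (simp add: S_def S_out del: sum.lessThan_Suc)
    then show ?thesis using False by simp
  qed
  have "(\<lambda>n. LINT z|\<nu>. S n z) \<longlonglongrightarrow> (LINT z|\<nu>. indicator {s<..t} (\<tau> z) * g (\<tau> z) z)"
  proof (rule integral_dominated_convergence[where w = w])
    show "(\<lambda>z. indicator {s<..t} (\<tau> z) * g (\<tau> z) z) \<in> borel_measurable \<nu>"
      by (rule borel_measurable_LIMSEQ_real[OF S_lim S_meas])
  qed (use S_lim S_bound S_meas w_int in auto)
  moreover have "(LINT z|\<nu>. S n z) =
      (\<Sum>i<Suc n. LINT z|\<nu>. indicator {grid s t n i<..grid s t n (Suc i)} (\<tau> z) * g (grid s t n (Suc i)) z)" for n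
    unfolding S_def
  proof (rule Bochner_Integration.integral_sum)
    fix i assume "i \<in> {..<Suc n}"
    then have i: "i < Suc n" by simp
    show "integrable \<nu> (\<lambda>z. indicator {grid s t n i<..grid s t n (Suc i)} (\<tau> z) * g (grid s t n (Suc i)) z)"
    proof (rule Bochner_Integration.integrable_bound[OF w_int])
      show "(\<lambda>z. indicator {grid s t n i<..grid s t n (Suc i)} (\<tau> z) * g (grid s t n (Suc i)) z) \<in> borel_measurable \<nu>"
        using i by (intro borel_measurable_times meas grid_in) auto
      have "\<bar>indicator {grid s t n i<..grid s t n (Suc i)} (\<tau> z) * g (grid s t n (Suc i)) z\<bar> \<le> \<bar>w z\<bar>"
        if z: "z \<in> space \<nu>" for z
      proof (cases "\<tau> z \<in> {s<..t}")
        case True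
        have "\<bar>g (grid s t n (Suc i)) z\<bar> \<le> B" using i by (intro bound z True grid_in) auto
        then show ?thesis using True by (auto simp: w_def abs_mult indicator_def)
      qed (simp add: S_out i)
      then show "AE z in \<nu>. norm (indicator {grid s t n i<..grid s t n (Suc i)} (\<tau> z) * g (grid s t n (Suc i)) z) \<le> norm (w z)"
        by simp
    qed
  qed
  ultimately show ?thesis by simp
qed

section \<open>Continuous functions on the space-time strip\<close>

lemma continuous_on_slice:
  assumes "continuous_on (A \<times> {0..1}) (\<lambda>(t, x). w t x)" "t \<in> A"
  shows "continuous_on {0..1} (w t)"
proof -
  have "continuous_on {0..1} ((\<lambda>(t, x). w t x) \<circ> Pair t)"
    using assms(2) by (intro continuous_on_compose continuous_on_subset[OF assms(1)] continuous_intros) auto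
  then show ?thesis by (simp add: comp_def)
qed

lemma continuous_on_time:
  assumes "continuous_on (A \<times> {0..1}) (\<lambda>(t, x). w t x)" "x \<in> {0..1}"
  shows "continuous_on A (\<lambda>t. w t x)"
proof -
  have "continuous_on A ((\<lambda>(t, x). w t x) \<circ> (\<lambda>t. (t, x)))"
    using assms(2) by (intro continuous_on_compose continuous_on_subset[OF assms(1)] continuous_intros) auto
  then show ?thesis by (simp add: comp_def)
qed

lemma continuous_on_mean:
  fixes w :: "real \<Rightarrow> real \<Rightarrow> real"
  assumes "continuous_on (A \<times> {0..1}) (\<lambda>(t, x). w t x)"
  shows "continuous_on A (\<lambda>t. mean (w t))"
proof (rule continuous_on_eq)
  show "continuous_on A (\<lambda>t. integral (cbox 0 1) (w t))"
    by (rule integral_continuous_on_param) (use assms in simp)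
  show "integral (cbox 0 1) (w t) = mean (w t)" if "t \<in> A" for t
    using lebesgue_integral_eq_integral[OF integrable_01[OF continuous_on_slice[OF assms that]]]
    by (simp add: mean_def)
qed

lemma continuous_on_inner_L:
  fixes w :: "real \<Rightarrow> real \<Rightarrow> real"
  assumes "continuous_on (A \<times> {0..1}) (\<lambda>(t, x). w t x)" "continuous_on {0..1} h"
  shows "continuous_on A (\<lambda>t. inner_L (w t) h)"
proof -
  have "continuous_on (A \<times> {0..1}) (\<lambda>z. (case z of (t, x) \<Rightarrow> w t x) * h (snd z))"
    by (intro continuous_on_mult assms continuous_on_compose2[OF assms(2)] continuous_intros) auto
  then have "continuous_on A (\<lambda>t. mean (\<lambda>x. w t x * h x))"
    using continuous_on_mean[of A "\<lambda>t x. w t x * h x"] by (simp add: case_prod_beta)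
  then show ?thesis by (simp add: inner_L_def mean_def)
qed

section \<open>Measures on the space-time strip\<close>

definition slab_integral :: "(real \<times> real) measure \<Rightarrow> real \<Rightarrow> real \<Rightarrow> (real \<times> real \<Rightarrow> real) \<Rightarrow> real" where
  "slab_integral \<eta> s t f = (LINT z|\<eta>. indicator {s<..t} (fst z) * f z)"

locale strip_measure =
  fixes T :: real and \<eta> :: "(real \<times> real) measure"
  assumes sets_eta: "sets \<eta> = sets (restrict_space borel ({0<..T} \<times> {0..1}))"
    and finite_away: "\<And>\<delta>. \<delta> \<in> {0<..T} \<Longrightarrow> emeasure \<eta> ({\<delta>..T} \<times> {0..1}) < \<infinity>"
begin

lemma space_eta: "space \<eta> = {0<..T} \<times> {0..1}"
  using sets_eq_imp_space_eq[OF sets_eta] by (simp add: space_restrict_space)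

lemma borel_Int_sets_eta: "X \<in> sets borel \<Longrightarrow> X \<inter> ({0<..T} \<times> {0..1}) \<in> sets \<eta>"
  unfolding sets_eta sets_restrict_space by (auto simp: Int_commute)

lemma measurable_eta_continuous:
  "continuous_on ({0<..T} \<times> {0..1}) f \<Longrightarrow> f \<in> borel_measurable \<eta>"
  using borel_measurable_continuous_on_restrict[of "{0<..T} \<times> {0..1}" f]
  by (simp add: measurable_cong_sets[OF sets_eta refl])

lemma measurable_eta_fst [measurable]: "fst \<in> borel_measurable \<eta>"
  by (intro measurable_eta_continuous continuous_intros)

lemma finite_slab:
  assumes "0 < s" "t \<le> T"
  shows "emeasure \<eta> {z\<in>space \<eta>. fst z \<in> {s<..t}} < \<infinity>"
proof (cases "s \<le> T")
  case True
  have "emeasure \<eta> {z\<in>space \<eta>. fst z \<in> {s<..t}} \<le> emeasure \<eta> ({s..T} \<times> {0..1})"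
  proof (rule emeasure_mono)
    have "({s..T} \<times> {0..1}) \<inter> ({0<..T} \<times> {0..1}) \<in> sets \<eta>"
      by (intro borel_Int_sets_eta borel_closed closed_Times) auto
    moreover have "({s..T} \<times> {0..1}) \<inter> ({0<..T} \<times> {0..1}) = {s..T} \<times> {0..(1::real)}"
      using assms by auto
    ultimately show "({s..T} \<times> {0..1}) \<in> sets \<eta>" by simp
  qed (use assms in \<open>auto simp: space_eta\<close>)
  then show ?thesis using finite_away[of s] assms True by (auto simp: order_le_less_trans)
next
  case False
  then have empty: "{z\<in>space \<eta>. fst z \<in> {s<..t}} = {}" using assms by (auto simp: space_eta)
  show ?thesis unfolding empty by simp
qed

lemma integrable_slab_bounded:
  fixes f :: "real \<times> real \<Rightarrow> real"
  assumes "0 < s" "t \<le> T" "f \<in> borel_measurable \<eta>"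
    and "\<And>z. z \<in> space \<eta> \<Longrightarrow> fst z \<in> {s<..t} \<Longrightarrow> \<bar>f z\<bar> \<le> B"
  shows "integrable \<eta> (\<lambda>z. indicator {s<..t} (fst z) * f z)"
proof -
  have ind: "integrable \<eta> (indicator {z\<in>space \<eta>. fst z \<in> {s<..t}} :: _ \<Rightarrow> real)"
    using finite_slab[OF assms(1,2)] by (intro integrable_real_indicator) auto
  have "integrable \<eta> (\<lambda>z. B * indicator {z\<in>space \<eta>. fst z \<in> {s<..t}} z)"
    by (intro integrable_mult_right ind)
  then show ?thesis
  proof (rule Bochner_Integration.integrable_bound)
    show "(\<lambda>z. indicator {s<..t} (fst z) * f z) \<in> borel_measurable \<eta>"
      using assms(3) by measurable
    have "\<bar>indicator {s<..t} (fst z) * f z\<bar> \<le> \<bar>B * indicator {z\<in>space \<eta>. fst z \<in> {s<..t}} z\<bar>"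
      if "z \<in> space \<eta>" for z
      using assms(4)[OF that] that by (auto simp: indicator_def)
    then show "AE z in \<eta>. norm (indicator {s<..t} (fst z) * f z)
        \<le> norm (B * indicator {z\<in>space \<eta>. fst z \<in> {s<..t}} z)" by simp
  qed
qed

lemma continuous_bounded_slab:
  fixes f :: "real \<times> real \<Rightarrow> real"
  assumes "0 < s" "continuous_on ({0<..T} \<times> {0..1}) f"
  shows "\<exists>B. \<forall>r\<in>{s..T}. \<forall>x\<in>{0..1}. \<bar>f (r, x)\<bar> \<le> B"
proof -
  have "compact (f ` ({s..T} \<times> {0..1}))"
    using assms(1) by (intro compact_continuous_image compact_Times continuous_on_subset[OF assms(2)]) auto
  then have "bounded (f ` ({s..T} \<times> {0..1}))" by (rule compact_imp_bounded)
  then obtain B where "\<forall>y\<in>f ` ({s..T} \<times> {0..1}). norm y \<le> B"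
    unfolding bounded_iff by (elim exE)
  then show ?thesis by (intro exI[of _ B]) auto
qed

lemma integrable_slab:
  fixes f :: "real \<times> real \<Rightarrow> real"
  assumes "0 < s" "t \<le> T" "continuous_on ({0<..T} \<times> {0..1}) f"
  shows "integrable \<eta> (\<lambda>z. indicator {s<..t} (fst z) * f z)"
proof -
  obtain B where "\<forall>r\<in>{s..T}. \<forall>x\<in>{0..1}. \<bar>f (r, x)\<bar> \<le> B"
    using continuous_bounded_slab[OF assms(1,3)] by blast
  then show ?thesis
    using assms(2) by (intro integrable_slab_bounded[where B = B] assms measurable_eta_continuous)
      (auto simp: space_eta)
qed

lemma slab_add:
  assumes "0 < s" "t \<le> T" "continuous_on ({0<..T} \<times> {0..1}) f" "continuous_on ({0<..T} \<times> {0..1}) g"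
  shows "slab_integral \<eta> s t (\<lambda>z. f z + g z) = slab_integral \<eta> s t f + slab_integral \<eta> s t g"
  unfolding slab_integral_def distrib_left
  by (intro Bochner_Integration.integral_add integrable_slab assms)

lemma slab_sum:
  assumes "0 < s" "t \<le> T" "\<And>i. i \<in> I \<Longrightarrow> continuous_on ({0<..T} \<times> {0..1}) (f i)"
  shows "slab_integral \<eta> s t (\<lambda>z. \<Sum>i\<in>I. f i z) = (\<Sum>i\<in>I. slab_integral \<eta> s t (f i))"
  unfolding slab_integral_def sum_distrib_left
  by (intro Bochner_Integration.integral_sum integrable_slab assms)

lemma slab_cmult: "slab_integral \<eta> s t (\<lambda>z. c * f z) = c * slab_integral \<eta> s t f"
  by (simp add: slab_integral_def mult.left_commute[of _ c])

lemma slab_cong: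
  "(\<And>r x. r \<in> {0<..T} \<Longrightarrow> x \<in> {0..1} \<Longrightarrow> f (r, x) = g (r, x)) \<Longrightarrow> slab_integral \<eta> s t f = slab_integral \<eta> s t g"
  unfolding slab_integral_def by (intro Bochner_Integration.integral_cong) (auto simp: space_eta)

lemma slab_nonneg:
  assumes "\<And>r x. r \<in> {0<..T} \<Longrightarrow> x \<in> {0..1} \<Longrightarrow> 0 \<le> f (r, x)"
  shows "0 \<le> slab_integral \<eta> s t f"
  unfolding slab_integral_def
  by (intro integral_nonneg_AE AE_I2 mult_nonneg_nonneg) (use assms in \<open>auto simp: space_eta\<close>)

text \<open>
  The contact condition for a nonnegative \<open>w\<close> says that \<open>w = 0\<close> almost everywhere for \<open>\<eta>\<close>.
\<close>

lemma slab_add_contact: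
  assumes w: "continuous_on ({0<..T} \<times> {0..1}) (\<lambda>(r, x). w r x)"
    and nonneg: "\<And>r x. r \<in> {0<..T} \<Longrightarrow> x \<in> {0..1} \<Longrightarrow> 0 \<le> w r x"
    and contact: "(\<integral>\<^sup>+z. ennreal (w (fst z) (snd z)) \<partial>\<eta>) = 0"
    and f: "continuous_on ({0<..T} \<times> {0..1}) f"
  shows "slab_integral \<eta> s t (\<lambda>z. w (fst z) (snd z) + f z) = slab_integral \<eta> s t f"
proof -
  have [measurable]: "(\<lambda>z. w (fst z) (snd z)) \<in> borel_measurable \<eta>"
    using measurable_eta_continuous[OF w] by (simp add: case_prod_beta')
  have [measurable]: "f \<in> borel_measurable \<eta>" by (rule measurable_eta_continuous[OF f])
  have "AE z in \<eta>. ennreal (w (fst z) (snd z)) = 0"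
    using contact by (subst (asm) nn_integral_0_iff_AE) auto
  then have "AE z in \<eta>. w (fst z) (snd z) = 0"
    using AE_space
  proof eventually_elim
    case (elim z)
    then have "0 \<le> w (fst z) (snd z)" by (intro nonneg) (auto simp: space_eta)
    with elim show ?case by (simp add: ennreal_eq_0_iff)
  qed
  then have "AE z in \<eta>. indicator {s<..t} (fst z) * (w (fst z) (snd z) + f z) = indicator {s<..t} (fst z) * f z"
    by eventually_elim simp
  then show ?thesis
    unfolding slab_integral_def by (intro integral_cong_AE) measurable
qed

lemma slab_riemann_stieltjes:
  assumes "0 < s" "s < t" "t \<le> T" "continuous_on ({0<..T} \<times> {0..1}) w"
  shows "(\<lambda>n. \<Sum>i<Suc n. slab_integral \<eta> (grid s t n i) (grid s t n (Suc i)) (\<lambda>z. w (grid s t n (Suc i), snd z)))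
    \<longlonglongrightarrow> slab_integral \<eta> s t w"
proof -
  obtain B where B: "\<forall>r\<in>{s..T}. \<forall>x\<in>{0..1}. \<bar>w (r, x)\<bar> \<le> B"
    using continuous_bounded_slab[OF assms(1,4)] by blast
  have "(\<lambda>n. \<Sum>i<Suc n. LINT z|\<eta>. indicator {grid s t n i<..grid s t n (Suc i)} (fst z) *
      w (grid s t n (Suc i), snd z))
    \<longlonglongrightarrow> (LINT z|\<eta>. indicator {s<..t} (fst z) * w (fst z, snd z))"
  proof (rule riemann_stieltjes_tendsto[where B = B])
    show "(\<lambda>z. w (r, snd z)) \<in> borel_measurable \<eta>" if "r \<in> {s..t}" for r
      using that assms by (intro measurable_eta_continuous continuous_on_compose2[OF assms(4)] continuous_intros) auto
    show "continuous_on {s..t} (\<lambda>r. w (r, snd z))" if "z \<in> space \<eta>" for z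
      using that assms by (intro continuous_on_compose2[OF assms(4)] continuous_intros) (auto simp: space_eta)
    show "\<bar>w (r, snd z)\<bar> \<le> B" if "z \<in> space \<eta>" "r \<in> {s..t}" for z r
      using that B assms by (auto simp: space_eta)
  qed (use assms finite_slab[of s t] in auto)
  then show ?thesis by (simp add: slab_integral_def)
qed

lemma continuous_fejer_mean_strip:
  assumes "continuous_on ({0<..T} \<times> {0..1}) (\<lambda>(r, x). w r x)"
  shows "continuous_on ({0<..T} \<times> {0..1}) (\<lambda>z. fejer_mean N (w (fst z)) (snd z))"
proof (rule continuous_on_eq)
  show "continuous_on ({0<..T} \<times> {0..1}) (\<lambda>z. mean (w (fst z)) +
      2 * (\<Sum>k=1..N. fejer_weight N k * inner_L (w (fst z)) (cosmode k) * cosmode k (snd z)))"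
    by (intro continuous_intros continuous_on_compose2[OF continuous_on_mean[OF assms]]
        continuous_on_compose2[OF continuous_on_inner_L[OF assms]]) auto
  show "mean (w (fst z)) + 2 * (\<Sum>k=1..N. fejer_weight N k * inner_L (w (fst z)) (cosmode k) * cosmode k (snd z))
      = fejer_mean N (w (fst z)) (snd z)" if "z \<in> {0<..T} \<times> {0..1}" for z
    using that by (intro fejer_mean_expansion[symmetric] continuous_on_slice[OF assms]) auto
qed

lemma slab_fejer_tendsto:
  assumes "0 < s" "t \<le> T" and w: "continuous_on ({0<..T} \<times> {0..1}) (\<lambda>(r, x). w r x)"
  shows "(\<lambda>N. slab_integral \<eta> s t (\<lambda>z. fejer_mean N (w (fst z)) (snd z)))
    \<longlonglongrightarrow> slab_integral \<eta> s t (\<lambda>z. w (fst z) (snd z))"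
proof -
  obtain B where B: "\<forall>r\<in>{s..T}. \<forall>x\<in>{0..1}. \<bar>w r x\<bar> \<le> B"
    using continuous_bounded_slab[OF assms(1) w] by auto
  show ?thesis
    unfolding slab_integral_def
  proof (rule integral_dominated_convergence[where w = "\<lambda>z. indicator {s<..t} (fst z) * B"])
    have w': "continuous_on ({0<..T} \<times> {0..1}) (\<lambda>z. w (fst z) (snd z))"
      using w by (simp add: case_prod_beta)
    show "(\<lambda>z. indicator {s<..t} (fst z) * w (fst z) (snd z)) \<in> borel_measurable \<eta>"
      using measurable_eta_continuous[OF w'] by measurable
    show "(\<lambda>z. indicator {s<..t} (fst z) * fejer_mean N (w (fst z)) (snd z)) \<in> borel_measurable \<eta>" for N
      using measurable_eta_continuous[OF continuous_fejer_mean_strip[OF w, of N]] by measurable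
    show "integrable \<eta> (\<lambda>z. indicator {s<..t} (fst z) * B)"
      by (intro integrable_slab assms continuous_intros)
    show "AE z in \<eta>. (\<lambda>N. indicator {s<..t} (fst z) * fejer_mean N (w (fst z)) (snd z))
        \<longlonglongrightarrow> indicator {s<..t} (fst z) * w (fst z) (snd z)"
      by (intro AE_I2 tendsto_intros fejer_mean_tendsto continuous_on_slice[OF w]) (auto simp: space_eta)
    have "\<bar>fejer_mean N (w r) x\<bar> \<le> B" if "r \<in> {0<..T}" "s < r" "r \<le> t" for N r x
      using that B by (intro fejer_mean_abs_le continuous_on_slice[OF w]) auto
    then show "AE z in \<eta>. norm (indicator {s<..t} (fst z) * fejer_mean N (w (fst z)) (snd z))
        \<le> indicator {s<..t} (fst z) * B" for N
      by (intro AE_I2) (auto simp: space_eta indicator_def)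
  qed
qed

end

text \<open>
  Continuous functions recover the mass of closed sets as a limit of
  \<open>max 0 (1 - m \<cdot> infdist z C)\<close>; closed sets are stable under intersections and generate the Borel
  sets.  The measures may be infinite near time \<open>0\<close>, so they are first compared on the slabs
  \<open>(T/(n+2), T] \<times> [0,1]\<close>, where they are finite, and the slabs then exhaust the strip.
\<close>

lemma strip_measure_eqI:
  assumes "strip_measure T \<eta>1" "strip_measure T \<eta>2" and "0 < T"
    and eq: "\<And>n w. continuous_on UNIV w \<Longrightarrow>
      slab_integral \<eta>1 (T / real (Suc (Suc n))) T w = slab_integral \<eta>2 (T / real (Suc (Suc n))) T w"
  shows "\<eta>1 = \<eta>2"
proof -
  interpret A: strip_measure T \<eta>1 by fact
  interpret B: strip_measure T \<eta>2 by fact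
  define S where "S n = {T / real (Suc (Suc n))<..T} \<times> {0..(1::real)}" for n
  have pos: "0 < T / real (Suc (Suc n))" for n using \<open>0 < T\<close> by simp
  have Ssub: "S n \<subseteq> {0<..T} \<times> {0..1}" for n
    unfolding S_def using pos[of n] by (auto intro: less_trans)
  have in_sets: "X \<inter> S n \<in> sets (restrict_space borel ({0<..T} \<times> {0..1}))" if "X \<in> sets borel" for X n
  proof -
    have "S n \<in> sets borel" unfolding S_def borel_prod[symmetric] by (intro pair_measureI) auto
    moreover have "X \<inter> S n = (X \<inter> S n) \<inter> ({0<..T} \<times> {0..1})" using Ssub[of n] by auto
    ultimately show ?thesis using that unfolding sets_restrict_space by (auto intro!: image_eqI[of _ _ "X \<inter> S n"])
  qed
  have closed_eq: "emeasure \<eta>1 (C \<inter> S n) = emeasure \<eta>2 (C \<inter> S n)" if C: "closed C" for C n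
  proof (cases "C = {}")
    case False
    define w where "w m z = max 0 (1 - real m * infdist z C)" for m z
    have w_cont: "continuous_on A (w m)" for A m
      unfolding w_def by (intro continuous_intros)
    have w_bound: "\<bar>w m z\<bar> \<le> 1" for m z
      by (simp add: w_def infdist_nonneg)
    have w_lim: "(\<lambda>m. w m z) \<longlonglongrightarrow> indicator C z" for z
    proof (cases "z \<in> C")
      case True then show ?thesis by (simp add: w_def)
    next
      case False
      then have d: "0 < infdist z C"
        using C \<open>C \<noteq> {}\<close> by (metis infdist_pos_not_in_closed)
      obtain m0 where m0: "1 / infdist z C < real m0" using reals_Archimedean2 by blast
      have "w m z = 0" if "m \<ge> m0" for m
      proof -
        have "1 / infdist z C < real m" using m0 that by linarith
        then show ?thesis using d by (simp add: w_def field_simps max_def)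
      qed
      then have "(\<lambda>m. w m z) \<longlonglongrightarrow> 0"
        by (intro tendsto_eventually) (auto simp: eventually_sequentially)
      then show ?thesis using False by simp
    qed
    have meas: "emeasure \<eta> (C \<inter> S n) = ennreal (slab_integral \<eta> (T / real (Suc (Suc n))) T (indicator C))"
      and lim: "(\<lambda>m. slab_integral \<eta> (T / real (Suc (Suc n))) T (w m))
         \<longlonglongrightarrow> slab_integral \<eta> (T / real (Suc (Suc n))) T (indicator C)"
      if \<eta>: "strip_measure T \<eta>" for \<eta>
    proof -
      interpret strip_measure T \<eta> by fact
      let ?s = "T / real (Suc (Suc n))"
      have CS: "C \<inter> S n \<in> sets \<eta>"
        using in_sets[of C n] C unfolding sets_eta by (auto intro: borel_closed)
      have fin: "emeasure \<eta> (C \<inter> S n) < \<infinity>"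
      proof -
        have "emeasure \<eta> (C \<inter> S n) \<le> emeasure \<eta> {z\<in>space \<eta>. fst z \<in> {?s<..T}}"
        proof (rule emeasure_mono)
          show "C \<inter> S n \<subseteq> {z\<in>space \<eta>. fst z \<in> {?s<..T}}"
            using Ssub[of n] unfolding space_eta by (auto simp: S_def)
        qed measurable
        then show ?thesis using finite_slab[OF pos[of n] order_refl] by (rule order_le_less_trans)
      qed
      have "slab_integral \<eta> ?s T (indicator C) = (LINT z|\<eta>. indicator (C \<inter> S n) z)"
        unfolding slab_integral_def
        by (intro Bochner_Integration.integral_cong) (auto simp: space_eta S_def indicator_def)
      also have "\<dots> = measure \<eta> (C \<inter> S n)"
        using CS fin by simp
      finally show "emeasure \<eta> (C \<inter> S n) = ennreal (slab_integral \<eta> ?s T (indicator C))"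
        using fin by (simp add: emeasure_eq_ennreal_measure less_top[symmetric])
      have meas_w: "w m \<in> borel_measurable \<eta>" for m
        by (intro measurable_eta_continuous w_cont)
      show "(\<lambda>m. slab_integral \<eta> ?s T (w m)) \<longlonglongrightarrow> slab_integral \<eta> ?s T (indicator C)"
        unfolding slab_integral_def
      proof (rule integral_dominated_convergence[where w = "\<lambda>z. indicator {?s<..T} (fst z) * 1"])
        show "integrable \<eta> (\<lambda>z. indicator {?s<..T} (fst z) * 1 :: real)"
          by (rule integrable_slab[OF pos]) auto
        show m1: "(\<lambda>z. indicator {?s<..T} (fst z) * w m z) \<in> borel_measurable \<eta>" for m
          using meas_w[of m] by measurable
        have lim1: "(\<lambda>m. indicator {?s<..T} (fst z) * w m z) \<longlonglongrightarrow> indicator {?s<..T} (fst z) * indicator C z" for z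
          by (intro tendsto_intros w_lim)
        then show "AE z in \<eta>. (\<lambda>m. indicator {?s<..T} (fst z) * w m z) \<longlonglongrightarrow> indicator {?s<..T} (fst z) * indicator C z"
          by simp
        show "(\<lambda>z. indicator {?s<..T} (fst z) * indicator C z :: real) \<in> borel_measurable \<eta>"
          by (rule borel_measurable_LIMSEQ_real[OF lim1 m1])
        show "AE z in \<eta>. norm (indicator {?s<..T} (fst z) * w m z) \<le> indicator {?s<..T} (fst z) * 1" for m
          using w_bound by (intro AE_I2) (auto simp: indicator_def)
      qed
    qed
    have "slab_integral \<eta>1 (T / real (Suc (Suc n))) T (indicator C) = slab_integral \<eta>2 (T / real (Suc (Suc n))) T (indicator C)"
      using lim[OF assms(1)] lim[OF assms(2)] unfolding eq[OF w_cont] by (rule LIMSEQ_unique)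
    then show ?thesis using meas[OF assms(1)] meas[OF assms(2)] by simp
  qed simp
  have slab_eq: "emeasure \<eta>1 (X \<inter> S n) = emeasure \<eta>2 (X \<inter> S n)" if X: "X \<in> sets borel" for X n
  proof -
    define \<mu> where "\<mu> \<eta> = distr (restrict_space \<eta> (S n)) borel (\<lambda>z. z)" for \<eta> :: "(real \<times> real) measure"
    have mu: "emeasure (\<mu> \<eta>) Y = emeasure \<eta> (Y \<inter> S n)" if "strip_measure T \<eta>" and Y: "Y \<in> sets borel" for Y \<eta>
    proof -
      interpret strip_measure T \<eta> by fact
      have Sn: "S n \<in> sets \<eta>" using in_sets[of UNIV n] by (simp add: sets_eta)
      have sp: "space (restrict_space \<eta> (S n)) = S n"
        using Ssub[of n] by (auto simp: space_restrict_space space_eta)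
      have id: "(\<lambda>z. z) \<in> measurable (restrict_space \<eta> (S n)) borel"
        by (intro measurable_restrict_space1 measurable_eta_continuous continuous_intros)
      have "emeasure (\<mu> \<eta>) Y = emeasure (restrict_space \<eta> (S n)) (Y \<inter> S n)"
        unfolding \<mu>_def using emeasure_distr[OF id Y] by (simp add: sp)
      also have "\<dots> = emeasure \<eta> (Y \<inter> S n)"
        using Sn sets.Int_space_eq2[OF Sn] by (intro emeasure_restrict_space) auto
      finally show ?thesis .
    qed
    have "\<mu> \<eta>1 = \<mu> \<eta>2"
    proof (rule measure_eqI_generator_eq[where E = "Collect closed" and \<Omega> = UNIV and A = "\<lambda>_. UNIV"])
      show "Int_stable (Collect (closed :: (real \<times> real) set \<Rightarrow> bool))"
        by (auto simp: Int_stable_def)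
      show "emeasure (\<mu> \<eta>1) C = emeasure (\<mu> \<eta>2) C" if "C \<in> Collect closed" for C
        using that mu[OF assms(1)] mu[OF assms(2)] closed_eq[of C n] by (simp add: borel_closed)
      show "sets (\<mu> \<eta>1) = sigma_sets UNIV (Collect closed)" "sets (\<mu> \<eta>2) = sigma_sets UNIV (Collect closed)"
        by (simp_all add: \<mu>_def borel_eq_closed)
      have "{z\<in>space \<eta>1. fst z \<in> {T / real (Suc (Suc n))<..T}} = S n"
        using Ssub[of n] unfolding A.space_eta by (auto simp: S_def)
      then show "emeasure (\<mu> \<eta>1) UNIV \<noteq> \<infinity>"
        using A.finite_slab[OF pos[of n] order_refl] mu[OF assms(1), of UNIV] by (simp add: less_top)
    qed auto
    then show ?thesis using mu[OF assms(1) X] mu[OF assms(2) X] by simp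
  qed
  have incseq_S: "incseq S"
  proof (rule incseq_SucI)
    fix n
    have "T / real (Suc (Suc (Suc n))) \<le> T / real (Suc (Suc n))"
      using \<open>0 < T\<close> by (intro divide_left_mono) auto
    then show "S n \<subseteq> S (Suc n)" by (auto simp: S_def simp del: of_nat_Suc)
  qed
  have union_S: "(\<Union>n. S n) = {0<..T} \<times> {0..1}"
  proof
    show "{0<..T} \<times> {0..1} \<subseteq> (\<Union>n. S n)"
    proof clarify
      fix r x :: real assume r: "r \<in> {0<..T}" and x: "x \<in> {0..1}"
      then have "0 < r / T" using \<open>0 < T\<close> by simp
      then obtain n where "inverse (real (Suc n)) < r / T" using reals_Archimedean by blast
      moreover have "inverse (real (Suc (Suc n))) \<le> inverse (real (Suc n))"
        by (intro le_imp_inverse_le) auto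
      ultimately have "inverse (real (Suc (Suc n))) < r / T" by linarith
      then have "T / real (Suc (Suc n)) < r" using \<open>0 < T\<close>
        by (simp add: field_simps del: of_nat_Suc)
      then show "(r, x) \<in> (\<Union>n. S n)" using r x by (auto simp: S_def intro!: exI[of _ n])
    qed
  qed (use Ssub in auto)
  show ?thesis
  proof (rule measure_eqI)
    show "sets \<eta>1 = sets \<eta>2" by (simp add: A.sets_eta B.sets_eta)
    fix X assume "X \<in> sets \<eta>1"
    then obtain Y where Y: "Y \<in> sets borel" "X = Y \<inter> ({0<..T} \<times> {0..1})"
      unfolding A.sets_eta sets_restrict_space by auto
    have X: "X = (\<Union>n. Y \<inter> S n)" using Y union_S by auto
    have inc: "incseq (\<lambda>n. Y \<inter> S n)" using incseq_S by (auto simp: incseq_def)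
    have "emeasure \<eta>1 X = (SUP n. emeasure \<eta>1 (Y \<inter> S n))"
      unfolding X using inc in_sets[OF Y(1)]
      by (intro SUP_emeasure_incseq[symmetric]) (auto simp: A.sets_eta)
    also have "\<dots> = (SUP n. emeasure \<eta>2 (Y \<inter> S n))" by (simp add: slab_eq[OF Y(1)])
    also have "\<dots> = emeasure \<eta>2 X"
      unfolding X using inc in_sets[OF Y(1)]
      by (intro SUP_emeasure_incseq) (auto simp: B.sets_eta)
    finally show "emeasure \<eta>1 X = emeasure \<eta>2 X" .
  qed
qed

section \<open>Rational times\<close>

text \<open>
  The equation holds almost surely only for each fixed pair of times, so a pathwise argument must
  work with countably many of them.  Rational multiples of \<open>T\<close> are dense, contain \<open>T\<close>, and
  contain every uniform grid between two of their members, which is all that the Riemann sums use.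
\<close>

definition rational_times :: "real \<Rightarrow> real set" where
  "rational_times T = (\<lambda>q. T * of_rat q) ` {q. 0 < q \<and> q \<le> 1}"

lemma countable_rational_times: "countable (rational_times T)"
  by (simp add: rational_times_def)

lemma rational_timesI:
  assumes "0 < T" "0 < T * of_rat q" "T * of_rat q \<le> T"
  shows "T * of_rat q \<in> rational_times T"
  unfolding rational_times_def
proof (rule imageI)
  have "(0::real) < of_rat q" using assms(1,2) zero_less_mult_pos by blast
  moreover have "of_rat q \<le> (1::real)"
    using assms(3) mult_le_cancel_left_pos[OF assms(1), of "of_rat q" 1] by simp
  ultimately show "q \<in> {q. 0 < q \<and> q \<le> 1}"
    by simp
qed

lemma rational_times_subset: "0 < T \<Longrightarrow> rational_times T \<subseteq> {0<..T}"
  by (auto simp: rational_times_def mult_le_cancel_left1)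

lemma rational_times_grid:
  assumes "0 < T" "s \<in> rational_times T" "t \<in> rational_times T" "s \<le> t" "i \<le> Suc n"
  shows "grid s t n i \<in> rational_times T"
proof -
  obtain a b where ab: "s = T * of_rat a" "t = T * of_rat b"
    using assms(2,3) by (auto simp: rational_times_def)
  have eq: "grid s t n i = T * of_rat (a + (b - a) * (of_nat i / of_nat (Suc n)))"
    by (simp add: grid_def ab of_rat_add of_rat_mult of_rat_diff of_rat_divide algebra_simps
        add_divide_distrib diff_divide_distrib del: of_nat_Suc)
  have "0 < s" "t \<le> T" using assms(2,3) rational_times_subset[OF assms(1)] by auto
  then have "0 < grid s t n i" "grid s t n i \<le> T"
    using grid_bounds[OF assms(4,5)] by auto
  then show ?thesis unfolding eq by (intro rational_timesI assms(1))
qed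

lemma rational_times_dense:
  assumes "0 < T" "0 \<le> a" "a < b" "b \<le> T"
  shows "\<exists>d\<in>rational_times T. a < d \<and> d < b"
proof -
  have "a / T < b / T" using assms by (simp add: divide_strict_right_mono)
  then obtain q where "a / T < of_rat q" "of_rat q < b / T" using of_rat_dense by blast
  then have "a < T * of_rat q" "T * of_rat q < b"
    using assms(1) by (simp_all add: field_simps)
  moreover from this have "T * of_rat q \<in> rational_times T"
    using assms by (intro rational_timesI) linarith+
  ultimately show ?thesis by blast
qed

lemma rational_times_fraction: "0 < T \<Longrightarrow> T / real (Suc n) \<in> rational_times T"
  using rational_timesI[of T "1 / of_nat (Suc n)"]
  by (simp add: of_rat_divide mult_le_cancel_left1 divide_le_eq del: of_nat_Suc)

lemma continuous_on_rational_times_constant: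
  fixes f :: "real \<Rightarrow> real"
  assumes "0 < T" "continuous_on {0<..T} f" "\<And>d. d \<in> rational_times T \<Longrightarrow> f d = c" "t \<in> {0<..T}"
  shows "f t = c"
proof -
  have "\<exists>d\<in>rational_times T. t - t / real (Suc (Suc n)) < d \<and> d < t" for n
    using assms(4) by (intro rational_times_dense assms(1)) (auto simp: field_simps)
  then obtain d where d: "\<And>n. d n \<in> rational_times T" "\<And>n. t - t / real (Suc (Suc n)) < d n" "\<And>n. d n < t"
    by metis
  have "d \<longlonglongrightarrow> t"
  proof (rule tendsto_sandwich)
    have "(\<lambda>n. t - t * inverse (real (Suc (Suc n)))) \<longlonglongrightarrow> t - t * 0"
      by (intro tendsto_intros LIMSEQ_Suc[OF LIMSEQ_inverse_real_of_nat])
    then show "(\<lambda>n. t - t / real (Suc (Suc n))) \<longlonglongrightarrow> t" by (simp add: divide_inverse)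
    show "\<forall>\<^sub>F n in sequentially. t - t / real (Suc (Suc n)) \<le> d n" "\<forall>\<^sub>F n in sequentially. d n \<le> t"
      by (intro always_eventually allI less_imp_le d)+
  qed (rule tendsto_const)
  then have "(\<lambda>n. f (d n)) \<longlonglongrightarrow> f t"
    using subsetD[OF rational_times_subset[OF assms(1)] d(1)] assms(4)
    by (intro continuous_on_tendsto_compose[OF assms(2)] always_eventually allI)
  then show ?thesis using d(1) by (simp add: assms(3) LIMSEQ_const_iff)
qed

text \<open>
  How the initial condition enters: a quantity at time \<open>t\<close> is bounded by a function of an earlier
  rational time \<open>s\<close>, and \<open>s\<close> is sent to \<open>0\<close>.
\<close>

lemma bounded_by_vanishing_at_zero:
  fixes \<beta> :: "real \<Rightarrow> real"
  assumes "0 < t" "t \<le> T" "(\<beta> \<longlongrightarrow> 0) (at 0 within {0..T})"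
    and "\<And>s. s \<in> rational_times T \<Longrightarrow> s < t \<Longrightarrow> c \<le> \<beta> s"
  shows "c \<le> 0"
proof (rule ccontr)
  assume "\<not> c \<le> 0"
  then have "\<forall>\<^sub>F s in at 0 within {0..T}. \<beta> s < c" using assms(3) by (intro order_tendstoD) auto
  then obtain d where d: "d > 0" "\<And>s. s \<in> {0..T} \<Longrightarrow> s \<noteq> 0 \<Longrightarrow> dist s 0 < d \<Longrightarrow> \<beta> s < c"
    unfolding eventually_at by blast
  have "0 < T" "0 < min d t" "min d t \<le> T" using assms(1,2) d(1) by auto
  then obtain s where s: "s \<in> rational_times T" "0 < s" "s < min d t"
    using rational_times_dense[of T 0 "min d t"] by blast
  then have "\<beta> s < c" using assms(2) by (intro d(2)) auto
  with assms(4)[of s] s show False by simp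
qed

section \<open>The integral over a time interval\<close>

text \<open>
  Dropping the left end point puts the drift term on the same half-open time cells as the
  reflection terms, over which all three are additive.
\<close>

lemma lebesgue_on_subinterval:
  fixes f :: "real \<Rightarrow> real"
  assumes "s \<le> x" "x \<le> y" "y \<le> t" "continuous_on {s..t} f"
  shows "(LINT r|lebesgue_on {x..y}. f r) = (LINT r|lebesgue_on {s..t}. indicator {x<..y} r * f r)"
proof -
  have "(LINT r|lebesgue_on {x..y}. f r) = (LINT r|lebesgue. indicator {x..y} r * f r)"
    by (subst integral_restrict_space) auto
  also have "\<dots> = (LINT r|lebesgue. indicator {s..t} r * (indicator {x<..y} r * f r))"
  proof -
    have m: "set_borel_measurable lebesgue {s..t} f"
      using integrable_restrict_space[of "{s..t}" lebesgue f] continuous_imp_integrable_real[OF assms(4)]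
      by (simp add: set_borel_measurable_def)
    have m1: "(\<lambda>r. indicator A r * f r) \<in> borel_measurable lebesgue"
      if A: "A \<subseteq> {s..t}" "A \<in> sets lebesgue" for A
    proof -
      have "(\<lambda>r. indicator A r * (indicator {s..t} r *\<^sub>R f r)) \<in> borel_measurable lebesgue"
        using m A(2) unfolding set_borel_measurable_def by (intro borel_measurable_times) auto
      moreover have "(\<lambda>r. indicator A r * (indicator {s..t} r *\<^sub>R f r)) = (\<lambda>r. indicator A r * f r)"
        by (rule ext) (use A(1) in \<open>auto split: split_indicator\<close>)
      ultimately show ?thesis by simp
    qed
    have eq: "(\<lambda>r. indicator {s..t} r * (indicator {x<..y} r * f r)) = (\<lambda>r. indicator {x<..y} r * f r)"
      using assms(1-3) by (auto simp: indicator_def)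
    have "AE r in lebesgue. r \<notin> {x}" by (intro AE_not_in) (auto simp: null_sets_def)
    then have "AE r in lebesgue. indicator {x..y} r * f r = indicator {x<..y} r * f r"
      by eventually_elim (auto simp: indicator_def)
    then show ?thesis
      unfolding eq using assms(1-3) by (intro integral_cong_AE m1) auto
  qed
  also have "\<dots> = (LINT r|lebesgue_on {s..t}. indicator {x<..y} r * f r)"
    by (subst integral_restrict_space) auto
  finally show ?thesis .
qed

section \<open>Pathwise uniqueness\<close>

text \<open>
  What remains of the problem for one fixed path.  The noise has cancelled in \<open>mode_equation\<close>,
  which therefore involves the difference \<open>u1 - u2\<close> and the signed measure \<open>\<eta>1 - \<eta>2\<close> only.
\<close>

locale reflected_pair =
  A: strip_measure T \<eta>1 + B: strip_measure T \<eta>2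
  for T :: real and \<eta>1 \<eta>2 :: "(real \<times> real) measure" +
  fixes u1 u2 :: "real \<Rightarrow> real \<Rightarrow> real"
  assumes T_pos: "0 < T"
    and cont1: "continuous_on ({0<..T} \<times> {0..1}) (\<lambda>(t, x). u1 t x)"
    and cont2: "continuous_on ({0<..T} \<times> {0..1}) (\<lambda>(t, x). u2 t x)"
    and nonneg1: "\<And>t x. t \<in> {0<..T} \<Longrightarrow> x \<in> {0..1} \<Longrightarrow> 0 \<le> u1 t x"
    and nonneg2: "\<And>t x. t \<in> {0<..T} \<Longrightarrow> x \<in> {0..1} \<Longrightarrow> 0 \<le> u2 t x"
    and contact1: "(\<integral>\<^sup>+z. ennreal (u1 (fst z) (snd z)) \<partial>\<eta>1) = 0"
    and contact2: "(\<integral>\<^sup>+z. ennreal (u2 (fst z) (snd z)) \<partial>\<eta>2) = 0"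
    and cont_init: "continuous_on {0..1} (u1 0)"
    and same_init: "\<And>x. x \<in> {0..1} \<Longrightarrow> u2 0 x = u1 0 x"
    and mean_init: "0 < mean (u1 0)"
    and attained1: "((\<lambda>s. norm_H (\<lambda>x. u1 s x - u1 0 x)) \<longlongrightarrow> 0) (at 0 within {0..T})"
    and attained2: "((\<lambda>s. norm_H (\<lambda>x. u2 s x - u2 0 x)) \<longlongrightarrow> 0) (at 0 within {0..T})"
    and mean_conserved1: "\<And>s t. s \<in> rational_times T \<Longrightarrow> t \<in> rational_times T \<Longrightarrow> s \<le> t \<Longrightarrow>
      mean (u1 t) = mean (u1 s)"
    and mean_conserved2: "\<And>s t. s \<in> rational_times T \<Longrightarrow> t \<in> rational_times T \<Longrightarrow> s \<le> t \<Longrightarrow>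
      mean (u2 t) = mean (u2 s)"
    and mode_equation: "\<And>s t k. s \<in> rational_times T \<Longrightarrow> t \<in> rational_times T \<Longrightarrow> s \<le> t \<Longrightarrow> 0 < k \<Longrightarrow>
      inner_L (\<lambda>x. u1 t x - u2 t x) (cosmode k) = inner_L (\<lambda>x. u1 s x - u2 s x) (cosmode k)
        - (eigenval k)\<^sup>2 / 2 * (LINT r|lebesgue_on {s..t}. inner_L (\<lambda>x. u1 r x - u2 r x) (cosmode k))
        + eigenval k / 2 * (slab_integral \<eta>1 s t (\<lambda>z. cosmode k (snd z))
                          - slab_integral \<eta>2 s t (\<lambda>z. cosmode k (snd z)))"
begin

definition v :: "real \<Rightarrow> real \<Rightarrow> real" where "v t x = u1 t x - u2 t x"

definition vcoeff :: "nat \<Rightarrow> real \<Rightarrow> real" where "vcoeff k t = inner_L (v t) (cosmode k)"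

lemma rational_times_bounds: "s \<in> rational_times T \<Longrightarrow> 0 < s" "s \<in> rational_times T \<Longrightarrow> s \<le> T"
  using rational_times_subset[OF T_pos] by auto

lemma cont_v: "continuous_on ({0<..T} \<times> {0..1}) (\<lambda>(t, x). v t x)"
  using continuous_on_diff[OF cont1 cont2] by (simp add: v_def case_prod_beta)

lemma cont_vcoeff: "continuous_on {0<..T} (vcoeff k)"
  unfolding vcoeff_def[abs_def] by (rule continuous_on_inner_L[OF cont_v]) (intro continuous_intros)

text \<open>
  This is \<open>d(a\<^sub>k\<^sup>2) \<le> \<lambda>\<^sub>k a\<^sub>k e\<^sub>k d(\<eta>1 - \<eta>2)\<close> for the \<open>k\<close>-th coefficient \<open>a\<^sub>k\<close> of \<open>u1 - u2\<close>.  On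
  each cell of a grid, \<open>a(y)\<^sup>2 - a(x)\<^sup>2 \<le> 2 a(y) (a(y) - a(x))\<close>, and the equation expresses the
  increment by integrals over the cell.  Summation and refinement give Stieltjes integrals; the
  drift contributes \<open>- \<lambda>\<^sub>k\<^sup>2 \<integral> a\<^sub>k\<^sup>2 \<le> 0\<close>, which is dropped.
\<close>

lemma mode_energy:
  assumes s: "s \<in> rational_times T" and t: "t \<in> rational_times T" and "s < t" "0 < k"
  shows "(vcoeff k t)\<^sup>2 - (vcoeff k s)\<^sup>2 \<le> eigenval k *
    (slab_integral \<eta>1 s t (\<lambda>z. vcoeff k (fst z) * cosmode k (snd z))
      - slab_integral \<eta>2 s t (\<lambda>z. vcoeff k (fst z) * cosmode k (snd z)))"
proof -
  note st = rational_times_bounds[OF s] rational_times_bounds[OF t]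
  have cont_st: "continuous_on {s..t} (vcoeff k)"
    using st by (intro continuous_on_subset[OF cont_vcoeff]) auto
  define p where "p n i = grid s t n i" for n i
  define L where "L n = (\<Sum>i<Suc n. LINT r|lebesgue_on {s..t}.
      indicator {p n i<..p n (Suc i)} r * (vcoeff k (p n (Suc i)) * vcoeff k r))" for n
  define R where "R \<eta> n = (\<Sum>i<Suc n. slab_integral \<eta> (p n i) (p n (Suc i))
      (\<lambda>z. vcoeff k (p n (Suc i)) * cosmode k (snd z)))" for \<eta> n
  have le: "(vcoeff k t)\<^sup>2 - (vcoeff k s)\<^sup>2 \<le> - (eigenval k)\<^sup>2 * L n + eigenval k * (R \<eta>1 n - R \<eta>2 n)" for n
  proof -
    have step: "(vcoeff k (p n (Suc i)))\<^sup>2 - (vcoeff k (p n i))\<^sup>2 \<le>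
       - (eigenval k)\<^sup>2 * (LINT r|lebesgue_on {s..t}. indicator {p n i<..p n (Suc i)} r * (vcoeff k (p n (Suc i)) * vcoeff k r))
       + eigenval k * (slab_integral \<eta>1 (p n i) (p n (Suc i)) (\<lambda>z. vcoeff k (p n (Suc i)) * cosmode k (snd z))
                     - slab_integral \<eta>2 (p n i) (p n (Suc i)) (\<lambda>z. vcoeff k (p n (Suc i)) * cosmode k (snd z)))"
      if i: "i < Suc n" for i
    proof -
      let ?x = "p n i" and ?y = "p n (Suc i)"
      have xy: "?x \<in> rational_times T" "?y \<in> rational_times T" "?x \<le> ?y" "s \<le> ?x" "?y \<le> t"
        using i \<open>s < t\<close> unfolding p_def
        by (auto intro!: rational_times_grid[OF T_pos s t] grid_mono grid_bounds)
      have "vcoeff k ?y - vcoeff k ?x =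
         - (eigenval k)\<^sup>2 / 2 * (LINT r|lebesgue_on {?x..?y}. vcoeff k r)
         + eigenval k / 2 * (slab_integral \<eta>1 ?x ?y (\<lambda>z. cosmode k (snd z))
                           - slab_integral \<eta>2 ?x ?y (\<lambda>z. cosmode k (snd z)))"
        using mode_equation[OF xy(1,2,3) \<open>0 < k\<close>] by (simp add: vcoeff_def v_def[abs_def])
      moreover have "(LINT r|lebesgue_on {?x..?y}. vcoeff k r)
          = (LINT r|lebesgue_on {s..t}. indicator {?x<..?y} r * vcoeff k r)"
        using xy by (intro lebesgue_on_subinterval cont_st)
      ultimately have "2 * vcoeff k ?y * (vcoeff k ?y - vcoeff k ?x) = 2 * vcoeff k ?y *
         (- (eigenval k)\<^sup>2 / 2 * (LINT r|lebesgue_on {s..t}. indicator {?x<..?y} r * vcoeff k r)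
         + eigenval k / 2 * (slab_integral \<eta>1 ?x ?y (\<lambda>z. cosmode k (snd z))
                           - slab_integral \<eta>2 ?x ?y (\<lambda>z. cosmode k (snd z))))"
        by (simp only:)
      also have "\<dots> =
         - (eigenval k)\<^sup>2 * (vcoeff k ?y * (LINT r|lebesgue_on {s..t}. indicator {?x<..?y} r * vcoeff k r))
         + eigenval k * (vcoeff k ?y * slab_integral \<eta>1 ?x ?y (\<lambda>z. cosmode k (snd z))
                       - vcoeff k ?y * slab_integral \<eta>2 ?x ?y (\<lambda>z. cosmode k (snd z)))"
        by (simp add: field_simps)
      also have "vcoeff k ?y * (LINT r|lebesgue_on {s..t}. indicator {?x<..?y} r * vcoeff k r)
          = (LINT r|lebesgue_on {s..t}. indicator {?x<..?y} r * (vcoeff k ?y * vcoeff k r))"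
        by (simp add: mult.left_commute[of "vcoeff k ?y"] flip: integral_mult_right_zero)
      finally have eq: "2 * vcoeff k ?y * (vcoeff k ?y - vcoeff k ?x) =
         - (eigenval k)\<^sup>2 * (LINT r|lebesgue_on {s..t}. indicator {?x<..?y} r * (vcoeff k ?y * vcoeff k r))
         + eigenval k * (slab_integral \<eta>1 ?x ?y (\<lambda>z. vcoeff k ?y * cosmode k (snd z))
                       - slab_integral \<eta>2 ?x ?y (\<lambda>z. vcoeff k ?y * cosmode k (snd z)))"
        by (simp only: A.slab_cmult B.slab_cmult)
      have "(vcoeff k ?y)\<^sup>2 - (vcoeff k ?x)\<^sup>2 \<le> 2 * vcoeff k ?y * (vcoeff k ?y - vcoeff k ?x)"
        using zero_le_power2[of "vcoeff k ?y - vcoeff k ?x"] by (simp add: power2_eq_square algebra_simps)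
      then show ?thesis using eq by simp
    qed
    have "(vcoeff k t)\<^sup>2 - (vcoeff k s)\<^sup>2 = (\<Sum>i<Suc n. (vcoeff k (p n (Suc i)))\<^sup>2 - (vcoeff k (p n i))\<^sup>2)"
      using sum_lessThan_telescope[of "\<lambda>i. (vcoeff k (p n i))\<^sup>2" "Suc n"]
      by (simp add: p_def del: sum.lessThan_Suc)
    also have "\<dots> \<le> - (eigenval k)\<^sup>2 * L n + eigenval k * (R \<eta>1 n - R \<eta>2 n)"
      unfolding L_def R_def sum_distrib_left sum_subtractf[symmetric] sum.distrib[symmetric]
      by (rule sum_mono) (use step in simp)
    finally show ?thesis .
  qed
  have Llim: "L \<longlonglongrightarrow> (LINT r|lebesgue_on {s..t}. indicator {s<..t} r * (vcoeff k r * vcoeff k r))"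
  proof -
    obtain B where "\<forall>y\<in>vcoeff k ` {s..t}. norm y \<le> B"
      using compact_imp_bounded[OF compact_continuous_image[OF cont_st compact_Icc]]
      unfolding bounded_iff by (elim exE)
    then have B: "\<bar>vcoeff k r\<bar> \<le> B" if "r \<in> {s..t}" for r using that by auto
    have meas: "vcoeff k \<in> borel_measurable (lebesgue_on {s..t})"
      using continuous_imp_integrable_real[OF cont_st] by (rule borel_measurable_integrable)
    show ?thesis
      unfolding L_def p_def
    proof (rule riemann_stieltjes_tendsto[where \<tau> = "\<lambda>r. r" and g = "\<lambda>q r. vcoeff k q * vcoeff k r" and B = "B * B"])
      show "(\<lambda>r. r) \<in> borel_measurable (lebesgue_on {s..t})"
        by (intro borel_measurable_integrable continuous_imp_integrable_real continuous_intros)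
      have "emeasure (lebesgue_on {s..t}) {z \<in> space (lebesgue_on {s..t}). z \<in> {s<..t}}
          \<le> emeasure (lebesgue_on {s..t}) (space (lebesgue_on {s..t}))"
        by (rule emeasure_space)
      also have "\<dots> < \<infinity>" using \<open>s < t\<close> by (simp add: space_restrict_space emeasure_restrict_space)
      finally show "emeasure (lebesgue_on {s..t}) {z \<in> space (lebesgue_on {s..t}). z \<in> {s<..t}} < \<infinity>" .
      show "\<bar>vcoeff k q * vcoeff k z\<bar> \<le> B * B"
        if "z \<in> space (lebesgue_on {s..t})" "q \<in> {s..t}" for z q
        using that B[of q] B[of z] unfolding abs_mult
        by (intro mult_mono) (auto intro: order_trans[OF abs_ge_zero])
    qed (use \<open>s < t\<close> meas cont_st in \<open>auto intro!: continuous_intros\<close>)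
  qed
  have L0: "0 \<le> (LINT r|lebesgue_on {s..t}. indicator {s<..t} r * (vcoeff k r * vcoeff k r))"
    by (intro integral_nonneg_AE AE_I2) simp
  have cont_ce: "continuous_on ({0<..T} \<times> {0..1}) (\<lambda>z. vcoeff k (fst z) * cosmode k (snd z))"
    by (intro continuous_intros continuous_on_compose2[OF cont_vcoeff]) auto
  have Rlim1: "R \<eta>1 \<longlonglongrightarrow> slab_integral \<eta>1 s t (\<lambda>z. vcoeff k (fst z) * cosmode k (snd z))"
    unfolding R_def p_def using A.slab_riemann_stieltjes[OF _ \<open>s < t\<close> _ cont_ce] st by simp
  have Rlim2: "R \<eta>2 \<longlonglongrightarrow> slab_integral \<eta>2 s t (\<lambda>z. vcoeff k (fst z) * cosmode k (snd z))"
    unfolding R_def p_def using B.slab_riemann_stieltjes[OF _ \<open>s < t\<close> _ cont_ce] st by simp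
  have "(\<lambda>n. - (eigenval k)\<^sup>2 * L n + eigenval k * (R \<eta>1 n - R \<eta>2 n)) \<longlonglongrightarrow>
      - (eigenval k)\<^sup>2 * (LINT r|lebesgue_on {s..t}. indicator {s<..t} r * (vcoeff k r * vcoeff k r)) +
      eigenval k * (slab_integral \<eta>1 s t (\<lambda>z. vcoeff k (fst z) * cosmode k (snd z))
      - slab_integral \<eta>2 s t (\<lambda>z. vcoeff k (fst z) * cosmode k (snd z)))"
    by (intro tendsto_intros Llim Rlim1 Rlim2)
  then have "(vcoeff k t)\<^sup>2 - (vcoeff k s)\<^sup>2 \<le>
      - (eigenval k)\<^sup>2 * (LINT r|lebesgue_on {s..t}. indicator {s<..t} r * (vcoeff k r * vcoeff k r)) +
      eigenval k * (slab_integral \<eta>1 s t (\<lambda>z. vcoeff k (fst z) * cosmode k (snd z))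
      - slab_integral \<eta>2 s t (\<lambda>z. vcoeff k (fst z) * cosmode k (snd z)))"
    by (rule LIMSEQ_le_const) (use le in blast)
  moreover have "0 \<le> (eigenval k)\<^sup>2 * (LINT r|lebesgue_on {s..t}. indicator {s<..t} r * (vcoeff k r * vcoeff k r))"
    by (intro mult_nonneg_nonneg L0) simp
  ultimately show ?thesis unfolding mult_minus_left by linarith
qed

lemma cont_v_pair: "continuous_on ({0<..T} \<times> {0..1}) (\<lambda>z. v (fst z) (snd z))"
  using cont_v by (simp add: case_prod_beta')

lemma cont_u_pair:
  "continuous_on ({0<..T} \<times> {0..1}) (\<lambda>z. u1 (fst z) (snd z))"
  "continuous_on ({0<..T} \<times> {0..1}) (\<lambda>z. u2 (fst z) (snd z))"
  using cont1 cont2 by (simp_all add: case_prod_beta')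

text \<open>
  The heart of uniqueness: where \<open>\<eta>1\<close> charges, \<open>u1 = 0\<close> and so \<open>u1 - u2 = - u2 \<le> 0\<close>; where \<open>\<eta>2\<close>
  charges, \<open>u1 - u2 = u1 \<ge> 0\<close>.
\<close>

lemma contact_sign:
  "slab_integral \<eta>1 s t (\<lambda>z. v (fst z) (snd z)) \<le> 0"
  "0 \<le> slab_integral \<eta>2 s t (\<lambda>z. v (fst z) (snd z))"
proof -
  have "slab_integral \<eta>1 s t (\<lambda>z. v (fst z) (snd z)) = slab_integral \<eta>1 s t (\<lambda>z. -1 * u2 (fst z) (snd z))"
    using A.slab_add_contact[OF cont1 nonneg1 contact1, of "\<lambda>z. -1 * u2 (fst z) (snd z)"]
    by (simp add: v_def continuous_intros cont_u_pair)
  also have "\<dots> = - slab_integral \<eta>1 s t (\<lambda>z. u2 (fst z) (snd z))"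
    by (subst A.slab_cmult) simp
  also have "\<dots> \<le> 0" using A.slab_nonneg[of "\<lambda>z. u2 (fst z) (snd z)"] nonneg2 by simp
  finally show "slab_integral \<eta>1 s t (\<lambda>z. v (fst z) (snd z)) \<le> 0" .
  have "0 \<le> slab_integral \<eta>2 s t (\<lambda>z. u1 (fst z) (snd z))"
    using B.slab_nonneg[of "\<lambda>z. u1 (fst z) (snd z)"] nonneg1 by simp
  also have "\<dots> = slab_integral \<eta>2 s t (\<lambda>z. u2 (fst z) (snd z) + v (fst z) (snd z))"
    by (simp add: v_def)
  also have "\<dots> = slab_integral \<eta>2 s t (\<lambda>z. v (fst z) (snd z))"
    by (rule B.slab_add_contact[OF cont2 nonneg2 contact2 cont_v_pair])
  finally show "0 \<le> slab_integral \<eta>2 s t (\<lambda>z. v (fst z) (snd z))" .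
qed

lemma cont_u_slice:
  assumes "t \<in> {0<..T}"
  shows "continuous_on {0..1} (u1 t)" "continuous_on {0..1} (u2 t)" "continuous_on {0..1} (v t)"
  using continuous_on_slice[OF cont1 assms] continuous_on_slice[OF cont2 assms]
    continuous_on_slice[OF cont_v assms] by auto

lemma mean_u1:
  assumes "t \<in> {0<..T}"
  shows "mean (u1 t) = mean (u1 0)"
proof (rule continuous_on_rational_times_constant[OF T_pos continuous_on_mean[OF cont1] _ assms])
  fix t assume t: "t \<in> rational_times T"
  have lim: "((\<lambda>s. (norm_H (\<lambda>x. u1 s x - u1 0 x))\<^sup>2) \<longlongrightarrow> 0) (at 0 within {0..T})"
    using tendsto_power[OF attained1, of 2] by simp
  have "(mean (u1 t) - mean (u1 0))\<^sup>2 \<le> 0"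
  proof (rule bounded_by_vanishing_at_zero[OF rational_times_bounds[OF t] lim])
    fix s assume s: "s \<in> rational_times T" "s < t"
    have cs: "continuous_on {0..1} (u1 s)" using rational_times_bounds[OF s(1)] by (intro cont_u_slice) auto
    have "(mean (\<lambda>x. u1 s x - u1 0 x))\<^sup>2 \<le> (norm_H (\<lambda>x. u1 s x - u1 0 x))\<^sup>2"
      using norm_H_lower_bound[of "\<lambda>x. u1 s x - u1 0 x" 0] by (simp add: continuous_intros cs cont_init)
    then show "(mean (u1 t) - mean (u1 0))\<^sup>2 \<le> (norm_H (\<lambda>x. u1 s x - u1 0 x))\<^sup>2"
      using mean_conserved1[OF s(1) t] s(2) by (simp add: mean_diff cs cont_init)
  qed
  then show "mean (u1 t) = mean (u1 0)" by simp
qed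

definition initial_gap :: "real \<Rightarrow> real" where
  "initial_gap s = 2 * (norm_H (\<lambda>x. u1 s x - u1 0 x))\<^sup>2 + 2 * (norm_H (\<lambda>x. u2 s x - u2 0 x))\<^sup>2"

lemma initial_gap_tendsto: "(initial_gap \<longlongrightarrow> 0) (at 0 within {0..T})"
proof -
  have "((\<lambda>s. 2 * (norm_H (\<lambda>x. u1 s x - u1 0 x))\<^sup>2 + 2 * (norm_H (\<lambda>x. u2 s x - u2 0 x))\<^sup>2)
      \<longlongrightarrow> 2 * 0\<^sup>2 + 2 * 0\<^sup>2) (at 0 within {0..T})"
    by (intro tendsto_intros attained1 attained2)
  then show ?thesis by (simp add: initial_gap_def[abs_def])
qed

text \<open>
  Both solutions start from the same datum, so the difference at time \<open>s\<close> is a difference of two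
  increments, each of which tends to \<open>0\<close> in \<open>H\<close> as \<open>s \<rightarrow> 0\<close>.
\<close>

lemma initial_gap_bound:
  assumes s: "s \<in> {0<..T}"
  shows "(mean (v s))\<^sup>2 + (\<Sum>k=1..N. 2 * (vcoeff k s)\<^sup>2 / eigenval k) \<le> initial_gap s"
proof -
  define f1 where "f1 x = u1 s x - u1 0 x" for x
  define f2 where "f2 x = u2 s x - u2 0 x" for x
  have c2: "continuous_on {0..1} (u2 0)"
    by (rule continuous_on_eq[OF cont_init]) (simp add: same_init)
  have c: "continuous_on {0..1} f1" "continuous_on {0..1} f2"
    unfolding f1_def f2_def by (intro continuous_on_diff cont_init c2 cont_u_slice[OF s])+
  have sq: "(a - b)\<^sup>2 \<le> 2 * a\<^sup>2 + 2 * b\<^sup>2" for a b :: real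
    using zero_le_power2[of "a + b"] by (simp add: power2_eq_square algebra_simps)
  have v_eq: "v s x = f1 x - f2 x" if "x \<in> {0..1}" for x
    using same_init[OF that] by (simp add: v_def f1_def f2_def)
  have m: "mean (v s) = mean f1 - mean f2"
    using mean_cong[of "v s" "\<lambda>x. f1 x - f2 x"] v_eq by (simp add: mean_diff c)
  have k: "vcoeff k s = inner_L f1 (cosmode k) - inner_L f2 (cosmode k)" for k
  proof -
    have "vcoeff k s = mean (\<lambda>x. f1 x * cosmode k x - f2 x * cosmode k x)"
      unfolding vcoeff_def inner_L_def mean_def[symmetric]
      by (rule mean_cong) (simp add: v_eq algebra_simps)
    then show ?thesis
      by (simp add: mean_diff continuous_intros c inner_L_def flip: mean_def)
  qed
  have mode_le: "2 * (vcoeff k s)\<^sup>2 / eigenval k \<le>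
      2 * (2 * (inner_L f1 (cosmode k))\<^sup>2 / eigenval k) + 2 * (2 * (inner_L f2 (cosmode k))\<^sup>2 / eigenval k)"
    if "k \<in> {1..N}" for k
  proof -
    have "2 * (vcoeff k s)\<^sup>2 / eigenval k
        \<le> 2 * (2 * (inner_L f1 (cosmode k))\<^sup>2 + 2 * (inner_L f2 (cosmode k))\<^sup>2) / eigenval k"
      using sq[of "inner_L f1 (cosmode k)" "inner_L f2 (cosmode k)"] eigenval_pos[of k] that
      unfolding k by (intro divide_right_mono mult_left_mono) auto
    then show ?thesis by (simp add: add_divide_distrib)
  qed
  have "(mean (v s))\<^sup>2 + (\<Sum>k=1..N. 2 * (vcoeff k s)\<^sup>2 / eigenval k) \<le>
     (2 * (mean f1)\<^sup>2 + 2 * (mean f2)\<^sup>2) +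
     (\<Sum>k=1..N. 2 * (2 * (inner_L f1 (cosmode k))\<^sup>2 / eigenval k) + 2 * (2 * (inner_L f2 (cosmode k))\<^sup>2 / eigenval k))"
    unfolding m by (intro add_mono sq sum_mono mode_le)
  also have "\<dots> = 2 * ((mean f1)\<^sup>2 + (\<Sum>k=1..N. 2 * (inner_L f1 (cosmode k))\<^sup>2 / eigenval k)) +
     2 * ((mean f2)\<^sup>2 + (\<Sum>k=1..N. 2 * (inner_L f2 (cosmode k))\<^sup>2 / eigenval k))"
    by (simp only: sum.distrib sum_distrib_left[symmetric] distrib_left)
  also have "\<dots> \<le> 2 * (norm_H f1)\<^sup>2 + 2 * (norm_H f2)\<^sup>2"
    by (intro add_mono mult_left_mono norm_H_lower_bound c) auto
  finally show ?thesis unfolding initial_gap_def f1_def f2_def .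
qed

lemma mean_v_zero:
  assumes "t \<in> {0<..T}"
  shows "mean (v t) = 0"
proof (rule continuous_on_rational_times_constant[OF T_pos continuous_on_mean[OF cont_v] _ assms])
  fix t assume t: "t \<in> rational_times T"
  have "(mean (v t))\<^sup>2 \<le> 0"
  proof (rule bounded_by_vanishing_at_zero[OF rational_times_bounds[OF t] initial_gap_tendsto])
    fix s assume s: "s \<in> rational_times T" "s < t"
    have st: "s \<in> {0<..T}" "t \<in> {0<..T}" using rational_times_bounds[OF s(1)] rational_times_bounds[OF t] by auto
    have "mean (v t) = mean (v s)"
      unfolding v_def[abs_def] using mean_conserved1[OF s(1) t] mean_conserved2[OF s(1) t] s(2)
      by (simp add: mean_diff cont_u_slice[OF st(1)] cont_u_slice[OF st(2)])
    then show "(mean (v t))\<^sup>2 \<le> initial_gap s"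
      using initial_gap_bound[OF st(1), of 0] by simp
  qed
  then show "mean (v t) = 0" by simp
qed

text \<open>
  The squared norm of \<open>H\<close> of \<open>u1 - u2\<close>, truncated with Fejer weights.
\<close>

definition energy :: "nat \<Rightarrow> real \<Rightarrow> real" where
  "energy N t = (\<Sum>k=1..N. fejer_weight N k * (2 * (vcoeff k t)\<^sup>2 / eigenval k))"

lemma fejer_mean_v:
  assumes "r \<in> {0<..T}"
  shows "fejer_mean N (v r) x = (\<Sum>k=1..N. (2 * fejer_weight N k) * (vcoeff k r * cosmode k x))"
  using mean_v_zero[OF assms]
  by (simp add: fejer_mean_expansion[OF cont_u_slice(3)[OF assms]] vcoeff_def sum_distrib_left algebra_simps)

text \<open>
  The weights \<open>2 fejer_weight / eigenval\<close> are chosen so that the modes add up to the Fejer mean of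
  \<open>u1 - u2\<close>.  Plain partial sums would not do, since the Fourier series of a continuous function
  need not converge at every point, and \<open>\<eta>1\<close> and \<open>\<eta>2\<close> may be concentrated on a small set.
\<close>

lemma energy_decrease:
  assumes s: "s \<in> rational_times T" and t: "t \<in> rational_times T" and "s < t"
  shows "energy N t - energy N s \<le>
    slab_integral \<eta>1 s t (\<lambda>z. fejer_mean N (v (fst z)) (snd z))
      - slab_integral \<eta>2 s t (\<lambda>z. fejer_mean N (v (fst z)) (snd z))"
proof -
  note st = rational_times_bounds[OF s] rational_times_bounds[OF t]
  let ?e = "\<lambda>k z. vcoeff k (fst z) * cosmode k (snd z)"
  have ce: "continuous_on ({0<..T} \<times> {0..1}) (\<lambda>z. c * ?e k z)" for c k
    by (intro continuous_intros continuous_on_compose2[OF cont_vcoeff]) auto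
  have slab: "slab_integral \<eta> s t (\<lambda>z. fejer_mean N (v (fst z)) (snd z)) =
      (\<Sum>k=1..N. 2 * fejer_weight N k * slab_integral \<eta> s t (?e k))" if "strip_measure T \<eta>" for \<eta>
  proof -
    interpret strip_measure T \<eta> by fact
    have "slab_integral \<eta> s t (\<lambda>z. fejer_mean N (v (fst z)) (snd z)) =
        slab_integral \<eta> s t (\<lambda>z. \<Sum>k=1..N. (2 * fejer_weight N k) * ?e k z)"
      by (rule slab_cong) (simp add: fejer_mean_v)
    also have "\<dots> = (\<Sum>k=1..N. slab_integral \<eta> s t (\<lambda>z. (2 * fejer_weight N k) * ?e k z))"
      by (intro slab_sum ce st)
    finally show ?thesis by (simp only: slab_cmult)
  qed
  have "energy N t - energy N s = (\<Sum>k=1..N. 2 * fejer_weight N k / eigenval k * ((vcoeff k t)\<^sup>2 - (vcoeff k s)\<^sup>2))"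
    unfolding energy_def sum_subtractf[symmetric] by (intro sum.cong refl) (simp add: algebra_simps diff_divide_distrib)
  also have "\<dots> \<le> (\<Sum>k=1..N. 2 * fejer_weight N k / eigenval k *
      (eigenval k * (slab_integral \<eta>1 s t (?e k) - slab_integral \<eta>2 s t (?e k))))"
    by (intro sum_mono mult_left_mono mode_energy s t \<open>s < t\<close> divide_nonneg_nonneg mult_nonneg_nonneg)
      (auto simp: fejer_weight_bounds eigenval_def)
  also have "\<dots> = (\<Sum>k=1..N. 2 * fejer_weight N k * slab_integral \<eta>1 s t (?e k)
      - 2 * fejer_weight N k * slab_integral \<eta>2 s t (?e k))"
  proof (rule sum.cong)
    fix k assume "k \<in> {1..N}"
    then have "eigenval k \<noteq> 0" using eigenval_pos[of k] by simp
    then show "2 * fejer_weight N k / eigenval k *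
        (eigenval k * (slab_integral \<eta>1 s t (?e k) - slab_integral \<eta>2 s t (?e k))) =
      2 * fejer_weight N k * slab_integral \<eta>1 s t (?e k) - 2 * fejer_weight N k * slab_integral \<eta>2 s t (?e k)"
      by (simp add: right_diff_distrib)
  qed simp
  finally show ?thesis
    unfolding slab[OF A.strip_measure_axioms] slab[OF B.strip_measure_axioms] sum_subtractf .
qed

text \<open>
  Two limits, in this order: \<open>N \<rightarrow> \<infinity>\<close> replaces the Fejer mean by \<open>u1 - u2\<close> itself, so that the
  boundary terms acquire their sign; then \<open>s \<rightarrow> 0\<close> removes the initial energy.  The order matters,
  as the measures may have infinite mass near time \<open>0\<close>; it is possible because the bound on the
  initial energy is uniform in \<open>N\<close>.
\<close>

lemma vcoeff_zero:
  assumes t: "t \<in> rational_times T" and "0 < k"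
  shows "vcoeff k t = 0"
proof -
  have "2 * (vcoeff k t)\<^sup>2 / eigenval k \<le> 0"
  proof (rule bounded_by_vanishing_at_zero[OF rational_times_bounds[OF t] initial_gap_tendsto])
    fix s assume s: "s \<in> rational_times T" "s < t"
    note st = rational_times_bounds[OF s(1)] rational_times_bounds[OF t]
    let ?P = "\<lambda>\<eta> N. slab_integral \<eta> s t (\<lambda>z. fejer_mean N (v (fst z)) (snd z))"
    have "(\<lambda>N. initial_gap s + (?P \<eta>1 N - ?P \<eta>2 N)) \<longlonglongrightarrow>
       initial_gap s + (slab_integral \<eta>1 s t (\<lambda>z. v (fst z) (snd z)) - slab_integral \<eta>2 s t (\<lambda>z. v (fst z) (snd z)))"
      by (intro tendsto_intros A.slab_fejer_tendsto B.slab_fejer_tendsto cont_v st)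
    moreover have "(\<lambda>N. fejer_weight N k * (2 * (vcoeff k t)\<^sup>2 / eigenval k)) \<longlonglongrightarrow> 1 * (2 * (vcoeff k t)\<^sup>2 / eigenval k)"
      by (intro tendsto_intros fejer_weight_tendsto)
    moreover have "\<forall>N\<ge>k. fejer_weight N k * (2 * (vcoeff k t)\<^sup>2 / eigenval k) \<le> initial_gap s + (?P \<eta>1 N - ?P \<eta>2 N)"
    proof (intro allI impI)
      fix N assume "k \<le> N"
      have nonneg: "0 \<le> fejer_weight N j * (2 * (vcoeff j t)\<^sup>2 / eigenval j)" if "j \<in> {1..N}" for j t
        using that by (intro mult_nonneg_nonneg divide_nonneg_nonneg) (auto simp: fejer_weight_bounds eigenval_def)
      have "fejer_weight N k * (2 * (vcoeff k t)\<^sup>2 / eigenval k) \<le> energy N t"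
        unfolding energy_def using \<open>k \<le> N\<close> \<open>0 < k\<close>
        by (intro member_le_sum[of k "{1..N}" "\<lambda>k. fejer_weight N k * (2 * (vcoeff k t)\<^sup>2 / eigenval k)"] nonneg) auto
      also have "\<dots> \<le> energy N s + (?P \<eta>1 N - ?P \<eta>2 N)"
        using energy_decrease[OF s(1) t s(2), of N] by simp
      also have "energy N s \<le> (\<Sum>k=1..N. 2 * (vcoeff k s)\<^sup>2 / eigenval k)"
        unfolding energy_def
        by (intro sum_mono mult_left_le_one_le divide_nonneg_nonneg) (auto simp: fejer_weight_bounds eigenval_def)
      also have "\<dots> \<le> initial_gap s"
      proof -
        have "s \<in> {0<..T}" using st by simp
        from initial_gap_bound[OF this, of N] show ?thesis
          using zero_le_power2[of "mean (v s)"] by linarith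
      qed
      finally show "fejer_weight N k * (2 * (vcoeff k t)\<^sup>2 / eigenval k) \<le> initial_gap s + (?P \<eta>1 N - ?P \<eta>2 N)"
        by simp
    qed
    ultimately have "1 * (2 * (vcoeff k t)\<^sup>2 / eigenval k) \<le> initial_gap s +
        (slab_integral \<eta>1 s t (\<lambda>z. v (fst z) (snd z)) - slab_integral \<eta>2 s t (\<lambda>z. v (fst z) (snd z)))"
      by (intro LIMSEQ_le) blast+
    then show "2 * (vcoeff k t)\<^sup>2 / eigenval k \<le> initial_gap s"
      using contact_sign[of s t] by linarith
  qed
  then show ?thesis
    using eigenval_pos[OF \<open>0 < k\<close>] by (simp add: divide_le_0_iff)
qed

theorem v_zero:
  assumes t: "t \<in> {0<..T}" and x: "x \<in> {0..1}"
  shows "v t x = 0"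
proof (rule continuous_on_rational_times_constant[OF T_pos continuous_on_time[OF cont_v x] _ t])
  fix t assume t: "t \<in> rational_times T"
  then have t': "t \<in> {0<..T}" using rational_times_bounds by auto
  have "fejer_mean N (v t) x = 0" for N
    using vcoeff_zero[OF t] by (simp add: fejer_mean_v[OF t'])
  then show "v t x = 0"
    using fejer_mean_tendsto[OF cont_u_slice(3)[OF t'] x] by (simp add: LIMSEQ_const_iff)
qed

lemma u_eq: "t \<in> {0<..T} \<Longrightarrow> x \<in> {0..1} \<Longrightarrow> u1 t x = u2 t x"
  using v_zero by (simp add: v_def)

definition excess :: "real \<Rightarrow> real \<Rightarrow> real" where
  "excess s t = slab_integral \<eta>1 s t (\<lambda>z. 1) - slab_integral \<eta>2 s t (\<lambda>z. 1)"

lemma slab_cosmode_eq: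
  assumes s: "s \<in> rational_times T" and t: "t \<in> rational_times T" and "s \<le> t" "0 < k"
  shows "slab_integral \<eta>1 s t (\<lambda>z. cosmode k (snd z)) = slab_integral \<eta>2 s t (\<lambda>z. cosmode k (snd z))"
proof -
  have zero: "inner_L (\<lambda>x. u1 r x - u2 r x) (cosmode k) = 0" if "r \<in> {0<..T}" for r
  proof -
    have "inner_L (\<lambda>x. u1 r x - u2 r x) (cosmode k) = mean (\<lambda>x. 0)"
      unfolding inner_L_def mean_def[symmetric] by (rule mean_cong) (simp add: u_eq[OF that])
    then show ?thesis by simp
  qed
  note st = rational_times_bounds[OF s] rational_times_bounds[OF t]
  have "(LINT r|lebesgue_on {s..t}. inner_L (\<lambda>x. u1 r x - u2 r x) (cosmode k)) = (LINT r|lebesgue_on {s..t}. 0)"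
    using st by (intro Bochner_Integration.integral_cong zero) auto
  then show ?thesis
    using mode_equation[OF s t \<open>s \<le> t\<close> \<open>0 < k\<close>] eigenval_pos[OF \<open>0 < k\<close>] st \<open>s \<le> t\<close>
    by (simp add: zero)
qed

text \<open>
  Once \<open>u1 = u2\<close>, the equation says that \<open>\<eta>1 - \<eta>2\<close> integrates every nonconstant cosine to \<open>0\<close>.
  Hence, as a measure in space, it is a multiple of Lebesgue measure on every slab, and only its
  total mass \<open>excess\<close> remains to be determined.
\<close>

lemma slab_difference:
  assumes s: "s \<in> rational_times T" and t: "t \<in> rational_times T" and "s \<le> t"
    and f: "continuous_on {0..1} f"
  shows "slab_integral \<eta>1 s t (\<lambda>z. f (snd z)) - slab_integral \<eta>2 s t (\<lambda>z. f (snd z)) = mean f * excess s t"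
proof -
  note st = rational_times_bounds[OF s] rational_times_bounds[OF t]
  have f': "continuous_on ({0<..T} \<times> {0..1}) (\<lambda>(r, x). f x)"
    unfolding case_prod_beta' by (intro continuous_on_compose2[OF f] continuous_intros) auto
  let ?P = "\<lambda>\<eta> N. slab_integral \<eta> s t (\<lambda>z. fejer_mean N f (snd z))"
  have P: "?P \<eta> N = mean f * slab_integral \<eta> s t (\<lambda>z. 1) +
      (\<Sum>k=1..N. 2 * fejer_weight N k * inner_L f (cosmode k) * slab_integral \<eta> s t (\<lambda>z. cosmode k (snd z)))"
    if "strip_measure T \<eta>" for \<eta> N
  proof -
    interpret strip_measure T \<eta> by fact
    have "?P \<eta> N = slab_integral \<eta> s t (\<lambda>z. mean f * 1 +
        (\<Sum>k=1..N. (2 * fejer_weight N k * inner_L f (cosmode k)) * cosmode k (snd z)))"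
      by (simp add: fejer_mean_expansion[OF f] sum_distrib_left algebra_simps)
    also have "\<dots> = slab_integral \<eta> s t (\<lambda>z. mean f * 1) +
        (\<Sum>k=1..N. slab_integral \<eta> s t (\<lambda>z. (2 * fejer_weight N k * inner_L f (cosmode k)) * cosmode k (snd z)))"
      by (subst slab_add slab_sum, (intro st continuous_intros)+)+ (rule refl)
    finally show ?thesis by (simp only: slab_cmult)
  qed
  have "?P \<eta>1 N - ?P \<eta>2 N = mean f * excess s t" for N
    unfolding P[OF A.strip_measure_axioms] P[OF B.strip_measure_axioms] excess_def
    using slab_cosmode_eq[OF s t \<open>s \<le> t\<close>] by (simp add: algebra_simps)
  moreover have "(\<lambda>N. ?P \<eta>1 N - ?P \<eta>2 N) \<longlonglongrightarrow>
      slab_integral \<eta>1 s t (\<lambda>z. f (snd z)) - slab_integral \<eta>2 s t (\<lambda>z. f (snd z))"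
    using A.slab_fejer_tendsto[OF st(1,4) f'] B.slab_fejer_tendsto[OF st(1,4) f'] by (intro tendsto_diff)
  ultimately show ?thesis by (simp add: LIMSEQ_const_iff)
qed

lemma excess_riemann:
  assumes s: "s \<in> rational_times T" and t: "t \<in> rational_times T" and "s < t"
    and w: "continuous_on ({0<..T} \<times> {0..1}) (\<lambda>z. w (fst z) (snd z))"
  shows "(\<lambda>n. \<Sum>i<Suc n. mean (w (grid s t n (Suc i))) * excess (grid s t n i) (grid s t n (Suc i)))
    \<longlonglongrightarrow> slab_integral \<eta>1 s t (\<lambda>z. w (fst z) (snd z)) - slab_integral \<eta>2 s t (\<lambda>z. w (fst z) (snd z))"
proof -
  note st = rational_times_bounds[OF s] rational_times_bounds[OF t]
  have step: "slab_integral \<eta>1 (grid s t n i) (grid s t n (Suc i)) (\<lambda>z. w (grid s t n (Suc i)) (snd z))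
      - slab_integral \<eta>2 (grid s t n i) (grid s t n (Suc i)) (\<lambda>z. w (grid s t n (Suc i)) (snd z))
      = mean (w (grid s t n (Suc i))) * excess (grid s t n i) (grid s t n (Suc i))" if i: "i < Suc n" for n i
  proof (rule slab_difference)
    show g: "grid s t n i \<in> rational_times T" "grid s t n (Suc i) \<in> rational_times T"
      using i \<open>s < t\<close> by (auto intro!: rational_times_grid[OF T_pos s t])
    show "grid s t n i \<le> grid s t n (Suc i)" using \<open>s < t\<close> by (intro grid_mono) auto
    show "continuous_on {0..1} (w (grid s t n (Suc i)))"
      using rational_times_bounds[OF g(2)] w
      by (intro continuous_on_slice[of "{0<..T}"]) (auto simp: case_prod_beta')
  qed
  have "(\<lambda>n. (\<Sum>i<Suc n. slab_integral \<eta>1 (grid s t n i) (grid s t n (Suc i)) (\<lambda>z. w (grid s t n (Suc i)) (snd z)))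
      - (\<Sum>i<Suc n. slab_integral \<eta>2 (grid s t n i) (grid s t n (Suc i)) (\<lambda>z. w (grid s t n (Suc i)) (snd z))))
    \<longlonglongrightarrow> slab_integral \<eta>1 s t (\<lambda>z. w (fst z) (snd z)) - slab_integral \<eta>2 s t (\<lambda>z. w (fst z) (snd z))"
    using A.slab_riemann_stieltjes[OF st(1) \<open>s < t\<close> st(4) w] B.slab_riemann_stieltjes[OF st(1) \<open>s < t\<close> st(4) w]
    by (intro tendsto_diff) simp_all
  moreover have "(\<Sum>i<Suc n. slab_integral \<eta>1 (grid s t n i) (grid s t n (Suc i)) (\<lambda>z. w (grid s t n (Suc i)) (snd z)))
      - (\<Sum>i<Suc n. slab_integral \<eta>2 (grid s t n i) (grid s t n (Suc i)) (\<lambda>z. w (grid s t n (Suc i)) (snd z)))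
      = (\<Sum>i<Suc n. mean (w (grid s t n (Suc i))) * excess (grid s t n i) (grid s t n (Suc i)))" for n
    unfolding sum_subtractf[symmetric] by (intro sum.cong refl step) simp
  ultimately show ?thesis by (simp only:)
qed

text \<open>
  Integrate \<open>u1 = u2\<close> itself.  By the contact conditions the integrals for \<open>\<eta>1\<close> and \<open>\<eta>2\<close> both
  vanish.  On the other hand their difference is the mass \<open>\<integral> u1 dx\<close>, which is conserved in time,
  times the excess.  As the initial mass is positive, the excess vanishes.
\<close>

lemma excess_zero:
  assumes s: "s \<in> rational_times T" and t: "t \<in> rational_times T" and "s \<le> t"
  shows "excess s t = 0"
proof (cases "s = t")
  case True then show ?thesis by (simp add: excess_def slab_integral_def)
next
  case False
  then have "s < t" using \<open>s \<le> t\<close> by simp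
  note st = rational_times_bounds[OF s] rational_times_bounds[OF t]
  have c1: "slab_integral \<eta>1 s t (\<lambda>z. u1 (fst z) (snd z)) = 0"
    using A.slab_add_contact[OF cont1 nonneg1 contact1, of "\<lambda>z. 0" s t] by (simp add: slab_integral_def)
  have "slab_integral \<eta>2 s t (\<lambda>z. u1 (fst z) (snd z)) = slab_integral \<eta>2 s t (\<lambda>z. u2 (fst z) (snd z))"
    by (rule B.slab_cong) (simp add: u_eq)
  also have c2: "\<dots> = 0"
    using B.slab_add_contact[OF cont2 nonneg2 contact2, of "\<lambda>z. 0" s t] by (simp add: slab_integral_def)
  finally have c2: "slab_integral \<eta>2 s t (\<lambda>z. u1 (fst z) (snd z)) = 0" .
  have m: "mean (u1 (grid s t n (Suc i))) = mean (u1 0)" if "i < Suc n" for n i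
  proof (rule mean_u1)
    have "s \<le> grid s t n (Suc i)" "grid s t n (Suc i) \<le> t"
      using grid_bounds[of s t "Suc i" n] \<open>s \<le> t\<close> that by auto
    then show "grid s t n (Suc i) \<in> {0<..T}" using st by simp
  qed
  have "(\<Sum>i<Suc n. mean (u1 (grid s t n (Suc i))) * excess (grid s t n i) (grid s t n (Suc i)))
      = mean (u1 0) * (\<Sum>i<Suc n. 1 * excess (grid s t n i) (grid s t n (Suc i)))" for n
    unfolding sum_distrib_left by (intro sum.cong refl) (simp add: m)
  then have "(\<lambda>n. mean (u1 0) * (\<Sum>i<Suc n. 1 * excess (grid s t n i) (grid s t n (Suc i)))) \<longlonglongrightarrow> 0"
    using excess_riemann[OF s t \<open>s < t\<close> cont_u_pair(1)] unfolding c1 c2 by (simp only: diff_self)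
  moreover have "(\<lambda>n. mean (u1 0) * (\<Sum>i<Suc n. 1 * excess (grid s t n i) (grid s t n (Suc i))))
      \<longlonglongrightarrow> mean (u1 0) * excess s t"
    using excess_riemann[OF s t \<open>s < t\<close>, of "\<lambda>_ _. 1"]
    by (intro tendsto_mult tendsto_const) (simp add: excess_def[of s t] del: sum.lessThan_Suc)
  ultimately have "mean (u1 0) * excess s t = 0" by (rule LIMSEQ_unique[symmetric])
  then show ?thesis using mean_init by simp
qed

theorem measures_eq: "\<eta>1 = \<eta>2"
proof (rule strip_measure_eqI[OF A.strip_measure_axioms B.strip_measure_axioms T_pos])
  fix n and w :: "real \<times> real \<Rightarrow> real" assume w: "continuous_on UNIV w"
  have s: "T / real (Suc (Suc n)) \<in> rational_times T" and t: "T \<in> rational_times T"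
    using rational_times_fraction[OF T_pos, of "Suc n"] rational_times_fraction[OF T_pos, of 0] by auto
  have lt: "T / real (Suc (Suc n)) < T" using T_pos by (simp add: field_simps add_pos_nonneg)
  have "excess (grid (T / real (Suc (Suc n))) T m i) (grid (T / real (Suc (Suc n))) T m (Suc i)) = 0"
    if "i < Suc m" for i m
    using that lt by (intro excess_zero rational_times_grid[OF T_pos s t] grid_mono) auto
  then have "(\<Sum>i<Suc m. mean (\<lambda>x. w (grid (T / real (Suc (Suc n))) T m (Suc i), x)) *
      excess (grid (T / real (Suc (Suc n))) T m i) (grid (T / real (Suc (Suc n))) T m (Suc i))) = 0" for m
    by (intro sum.neutral) (simp del: of_nat_Suc)
  then have "(\<lambda>m. 0) \<longlonglongrightarrow> slab_integral \<eta>1 (T / real (Suc (Suc n))) T (\<lambda>z. w (fst z, snd z))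
      - slab_integral \<eta>2 (T / real (Suc (Suc n))) T (\<lambda>z. w (fst z, snd z))"
    using excess_riemann[OF s t lt, of "\<lambda>r x. w (r, x)"] continuous_on_subset[OF w subset_UNIV]
    by (simp del: sum.lessThan_Suc of_nat_Suc cong: sum.cong)
  then show "slab_integral \<eta>1 (T / real (Suc (Suc n))) T w = slab_integral \<eta>2 (T / real (Suc (Suc n))) T w"
    by (simp add: LIMSEQ_const_iff del: of_nat_Suc)
qed

end

section \<open>From weak solutions to paths\<close>

lemma weak_solution_strip_measure:
  assumes "weak_solution M F T u \<eta> W"
  shows "AE \<omega> in M. strip_measure T (\<eta> \<omega>)"
proof -
  have "AE \<omega> in M. sets (\<eta> \<omega>) = sets (restrict_space borel ({0<..T} \<times> {0..1})) \<and>
        (\<forall>\<delta>\<in>{0<..T}. emeasure (\<eta> \<omega>) ({\<delta>..T} \<times> {0..1}) < \<infinity>)"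
    using assms by (simp only: weak_solution_def)
  then show ?thesis by eventually_elim (simp add: strip_measure_def)
qed

lemma weak_solution_path:
  assumes "weak_solution M F T u \<eta> W" "0 < T"
  shows "AE \<omega> in M. continuous_on ({0<..T} \<times> {0..1}) (\<lambda>(t, x). u t x \<omega>) \<and>
    (\<forall>t\<in>{0<..T}. \<forall>x\<in>{0..1}. 0 \<le> u t x \<omega>) \<and>
    (\<integral>\<^sup>+z. ennreal (u (fst z) (snd z) \<omega>) \<partial>\<eta> \<omega>) = 0 \<and>
    ((\<lambda>s. norm_H (\<lambda>x. u s x \<omega> - u 0 x \<omega>)) \<longlongrightarrow> 0) (at 0 within {0..T})"
proof -
  have 1: "AE \<omega> in M.
        continuous_on ({0<..T} \<times> {0..1}) (\<lambda>(t, \<theta>). u t \<theta> \<omega>) \<and>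
        (\<forall>t\<in>{0<..T}. \<forall>\<theta>\<in>{0..1}. u t \<theta> \<omega> \<ge> 0) \<and>
        continuous_on_H {0..T} (\<lambda>t \<theta>. u t \<theta> \<omega>)"
    and 2: "AE \<omega> in M. (\<integral>\<^sup>+z. ennreal (u (fst z) (snd z) \<omega>) \<partial>\<eta> \<omega>) = 0"
    using assms(1) by (simp_all only: weak_solution_def)
  have zero: "0 \<in> {0..T}" using assms(2) by simp
  from 1 2 show ?thesis
    by eventually_elim (use zero in \<open>simp add: continuous_on_H_def\<close>)
qed

lemma weak_solution_equation:
  assumes "weak_solution M F T u \<eta> W" "dom_A2 h h' Ah A2h" "0 < s" "s \<le> t" "t \<le> T"
  shows "AE \<omega> in M.
    inner_L (\<lambda>\<theta>. u t \<theta> \<omega>) h = inner_L (\<lambda>\<theta>. u s \<theta> \<omega>) h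
      - 1/2 * (LINT r|lebesgue_on {s..t}. inner_L (\<lambda>\<theta>. u r \<theta> \<omega>) A2h)
      - 1/2 * slab_integral (\<eta> \<omega>) s t (\<lambda>z. Ah (snd z))
      - wiener_integral M T W (\<lambda>(r, \<theta>). indicator {s<..t} r * h' \<theta>) \<omega>"
proof -
  have "AE \<omega> in M.
           inner_L (\<lambda>\<theta>. u t \<theta> \<omega>) h =
             inner_L (\<lambda>\<theta>. u s \<theta> \<omega>) h
             - 1/2 * (LINT r|lebesgue_on {s..t}. inner_L (\<lambda>\<theta>. u r \<theta> \<omega>) A2h)
             - 1/2 * (LINT z:{s<..t} \<times> {0..1}|\<eta> \<omega>. Ah (snd z))
             - wiener_integral M T W (\<lambda>(r, \<theta>). indicator {s<..t} r * h' \<theta>) \<omega>"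
    using assms unfolding weak_solution_def by blast
  then show ?thesis
    using weak_solution_strip_measure[OF assms(1)]
  proof eventually_elim
    case (elim \<omega>)
    interpret strip_measure T "\<eta> \<omega>" by fact
    have "(LINT z:{s<..t} \<times> {0..1}|\<eta> \<omega>. Ah (snd z)) = slab_integral (\<eta> \<omega>) s t (\<lambda>z. Ah (snd z))"
      unfolding set_lebesgue_integral_def slab_integral_def
      by (intro Bochner_Integration.integral_cong) (auto simp: space_eta indicator_def)
    with elim(1) show ?case by simp
  qed
qed

text \<open>
  For the test function \<open>1\<close> the equation has no drift, no reflection and the noise term is a chosen
  version of the integral of \<open>0\<close>.  This version is the same for all pairs of times; the trivial
  equation from \<open>t\<close> to \<open>t\<close> shows that it vanishes almost surely.
\<close>

lemma weak_solution_mean_conserved: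
  assumes sol: "weak_solution M F T u \<eta> W" and st: "0 < s" "s \<le> t" "t \<le> T"
  shows "AE \<omega> in M. mean (\<lambda>\<theta>. u t \<theta> \<omega>) = mean (\<lambda>\<theta>. u s \<theta> \<omega>)"
proof -
  have dom: "dom_A2 (\<lambda>x. 1) (\<lambda>x. 0) (\<lambda>x. 0) (\<lambda>x. 0)"
    using dom_A2_cosmode[of 0] by (simp add: eigenval_def)
  have eq: "AE \<omega> in M. mean (\<lambda>\<theta>. u t \<theta> \<omega>) = mean (\<lambda>\<theta>. u r \<theta> \<omega>) - wiener_integral M T W (\<lambda>_. 0) \<omega>"
    if "0 < r" "r \<le> t" for r
    using weak_solution_equation[OF sol dom that st(3)]
    by (simp add: inner_L_def mean_def slab_integral_def case_prod_beta')
  have "AE \<omega> in M. wiener_integral M T W (\<lambda>_. 0) \<omega> = 0"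
    using eq[of t] st by simp
  with eq[OF st(1,2)] show ?thesis by eventually_elim simp
qed

lemma weak_solution_mode:
  assumes sol: "weak_solution M F T u \<eta> W" and st: "0 < s" "s \<le> t" "t \<le> T"
  shows "AE \<omega> in M. inner_L (\<lambda>\<theta>. u t \<theta> \<omega>) (cosmode k) = inner_L (\<lambda>\<theta>. u s \<theta> \<omega>) (cosmode k)
      - (eigenval k)\<^sup>2 / 2 * (LINT r|lebesgue_on {s..t}. inner_L (\<lambda>\<theta>. u r \<theta> \<omega>) (cosmode k))
      + eigenval k / 2 * slab_integral (\<eta> \<omega>) s t (\<lambda>z. cosmode k (snd z))
      - wiener_integral M T W (\<lambda>(r, \<theta>). indicator {s<..t} r * - (real k * pi * sin (real k * pi * \<theta>))) \<omega>"
  using weak_solution_equation[OF sol dom_A2_cosmode[of k] st] weak_solution_strip_measure[OF sol]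
proof eventually_elim
  case (elim \<omega>)
  interpret strip_measure T "\<eta> \<omega>" by fact
  have 1: "inner_L f (\<lambda>x. (eigenval k)\<^sup>2 * cosmode k x) = (eigenval k)\<^sup>2 * inner_L f (cosmode k)" for f
    using mean_cmult[of "(eigenval k)\<^sup>2" "\<lambda>x. f x * cosmode k x"]
    by (simp add: inner_L_def mean_def mult.left_commute)
  have 2: "slab_integral (\<eta> \<omega>) s t (\<lambda>z. - (eigenval k * cosmode k (snd z)))
      = - (eigenval k * slab_integral (\<eta> \<omega>) s t (\<lambda>z. cosmode k (snd z)))"
    using slab_cmult[of s t "- eigenval k" "\<lambda>z. cosmode k (snd z)"] by simp
  show ?case using elim(1) unfolding 1 2 by simp
qed

text \<open>
  Both equations contain literally the same version of the Wiener integral, so it cancels.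
\<close>

lemma mode_equation_difference:
  assumes 1: "weak_solution M F T u1 \<eta>1 W" and 2: "weak_solution M F T u2 \<eta>2 W"
    and st: "0 < s" "s \<le> t" "t \<le> T"
  shows "AE \<omega> in M.
      inner_L (\<lambda>x. u1 t x \<omega> - u2 t x \<omega>) (cosmode k) = inner_L (\<lambda>x. u1 s x \<omega> - u2 s x \<omega>) (cosmode k)
        - (eigenval k)\<^sup>2 / 2 * (LINT r|lebesgue_on {s..t}. inner_L (\<lambda>x. u1 r x \<omega> - u2 r x \<omega>) (cosmode k))
        + eigenval k / 2 * (slab_integral (\<eta>1 \<omega>) s t (\<lambda>z. cosmode k (snd z))
                          - slab_integral (\<eta>2 \<omega>) s t (\<lambda>z. cosmode k (snd z)))"
proof -
  have T: "0 < T" using st by simp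
  show ?thesis
    using weak_solution_mode[OF 1 st, of k] weak_solution_mode[OF 2 st, of k]
      weak_solution_path[OF 1 T] weak_solution_path[OF 2 T]
  proof eventually_elim
    case (elim \<omega>)
    then have c: "continuous_on ({0<..T} \<times> {0..1}) (\<lambda>(t, x). u1 t x \<omega>)"
      "continuous_on ({0<..T} \<times> {0..1}) (\<lambda>(t, x). u2 t x \<omega>)" by auto
    have diff: "inner_L (\<lambda>x. u1 r x \<omega> - u2 r x \<omega>) (cosmode k)
        = inner_L (\<lambda>x. u1 r x \<omega>) (cosmode k) - inner_L (\<lambda>x. u2 r x \<omega>) (cosmode k)" if "r \<in> {s..t}" for r
    proof -
      have r: "r \<in> {0<..T}" using that st by auto
      have "mean (\<lambda>x. u1 r x \<omega> * cosmode k x - u2 r x \<omega> * cosmode k x)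
          = mean (\<lambda>x. u1 r x \<omega> * cosmode k x) - mean (\<lambda>x. u2 r x \<omega> * cosmode k x)"
        by (intro mean_diff continuous_intros continuous_on_slice[OF c(1) r] continuous_on_slice[OF c(2) r])
      then show ?thesis by (simp add: inner_L_def left_diff_distrib flip: mean_def)
    qed
    have int: "integrable (lebesgue_on {s..t}) (\<lambda>r. inner_L (\<lambda>x. w r x) (cosmode k))"
      if "continuous_on ({0<..T} \<times> {0..1}) (\<lambda>(t, x). w t x)" for w
      using st by (intro continuous_imp_integrable_real
          continuous_on_subset[OF continuous_on_inner_L[OF that]] continuous_intros) auto
    have "(LINT r|lebesgue_on {s..t}. inner_L (\<lambda>x. u1 r x \<omega> - u2 r x \<omega>) (cosmode k)) =
      (LINT r|lebesgue_on {s..t}. inner_L (\<lambda>x. u1 r x \<omega>) (cosmode k) - inner_L (\<lambda>x. u2 r x \<omega>) (cosmode k))"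
      by (intro Bochner_Integration.integral_cong) (auto simp: diff)
    also have "\<dots> = (LINT r|lebesgue_on {s..t}. inner_L (\<lambda>x. u1 r x \<omega>) (cosmode k))
        - (LINT r|lebesgue_on {s..t}. inner_L (\<lambda>x. u2 r x \<omega>) (cosmode k))"
      by (intro Bochner_Integration.integral_diff int[OF c(1)] int[OF c(2)])
    finally have I: "(LINT r|lebesgue_on {s..t}. inner_L (\<lambda>x. u1 r x \<omega> - u2 r x \<omega>) (cosmode k)) = \<dots>" .
    have ends: "s \<in> {s..t}" "t \<in> {s..t}" using st by auto
    show ?case
      unfolding I diff[OF ends(1)] diff[OF ends(2)] elim(1) elim(2) by (simp add: algebra_simps)
  qed
qed

theorem proposition4p1:
  fixes M :: "'a measure" and F :: "real \<Rightarrow> 'a measure" and T :: real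
    and u0 :: "real \<Rightarrow> 'a \<Rightarrow> real"
    and u1 u2 W :: "real \<Rightarrow> real \<Rightarrow> 'a \<Rightarrow> real"
    and \<eta>1 \<eta>2 :: "'a \<Rightarrow> (real \<times> real) measure"
  assumes "0 < T"
    and "AE \<omega> in M. continuous_on {0..1} (\<lambda>\<theta>. u0 \<theta> \<omega>)"
    and "AE \<omega> in M. \<forall>\<theta>\<in>{0..1}. u0 \<theta> \<omega> \<ge> 0"
    and "AE \<omega> in M. mean (\<lambda>\<theta>. u0 \<theta> \<omega>) > 0"
    and "indep_initial_noise M T u0 W"
    and "weak_solution M F T u1 \<eta>1 W"
    and "weak_solution M F T u2 \<eta>2 W"
    and "AE \<omega> in M. \<forall>\<theta>\<in>{0..1}. u1 0 \<theta> \<omega> = u0 \<theta> \<omega>"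
    and "AE \<omega> in M. \<forall>\<theta>\<in>{0..1}. u2 0 \<theta> \<omega> = u0 \<theta> \<omega>"
  shows "AE \<omega> in M. (\<forall>t\<in>{0..T}. \<forall>\<theta>\<in>{0..1}. u1 t \<theta> \<omega> = u2 t \<theta> \<omega>) \<and> \<eta>1 \<omega> = \<eta>2 \<omega>"
proof -
  note sol1 = assms(6) and sol2 = assms(7)
  let ?D = "rational_times T"
  have D: "0 < s" "s \<le> T" if "s \<in> ?D" for s
    using rational_times_subset[OF \<open>0 < T\<close>] that by auto
  have conserved: "AE \<omega> in M. \<forall>s\<in>?D. \<forall>t\<in>?D. s \<le> t \<longrightarrow> mean (\<lambda>\<theta>. u t \<theta> \<omega>) = mean (\<lambda>\<theta>. u s \<theta> \<omega>)"
    if "weak_solution M F T u \<eta> W" for u \<eta>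
    by (intro AE_ball_countable' countable_rational_times AE_impI weak_solution_mean_conserved[OF that] D)
  have modes: "AE \<omega> in M. \<forall>s\<in>?D. \<forall>t\<in>?D. s \<le> t \<longrightarrow> (\<forall>k.
      inner_L (\<lambda>x. u1 t x \<omega> - u2 t x \<omega>) (cosmode k) = inner_L (\<lambda>x. u1 s x \<omega> - u2 s x \<omega>) (cosmode k)
        - (eigenval k)\<^sup>2 / 2 * (LINT r|lebesgue_on {s..t}. inner_L (\<lambda>x. u1 r x \<omega> - u2 r x \<omega>) (cosmode k))
        + eigenval k / 2 * (slab_integral (\<eta>1 \<omega>) s t (\<lambda>z. cosmode k (snd z))
                          - slab_integral (\<eta>2 \<omega>) s t (\<lambda>z. cosmode k (snd z))))"
    by (intro AE_ball_countable' countable_rational_times AE_impI AE_all_countable[THEN iffD2] allI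
        mode_equation_difference[OF sol1 sol2] D)
  show ?thesis
    using assms(2,4,8,9) weak_solution_strip_measure[OF sol1] weak_solution_strip_measure[OF sol2]
      weak_solution_path[OF sol1 \<open>0 < T\<close>] weak_solution_path[OF sol2 \<open>0 < T\<close>]
      conserved[OF sol1] conserved[OF sol2] modes
  proof eventually_elim
    case (elim \<omega>)
    have init: "continuous_on {0..1} (\<lambda>x. u1 0 x \<omega>)"
      by (rule continuous_on_eq[OF elim(1)]) (use elim(3) in simp)
    have "mean (\<lambda>x. u1 0 x \<omega>) = mean (\<lambda>x. u0 x \<omega>)"
      by (rule mean_cong) (use elim(3) in simp)
    then have mean0: "0 < mean (\<lambda>x. u1 0 x \<omega>)" using elim(2) by simp
    have "reflected_pair T (\<eta>1 \<omega>) (\<eta>2 \<omega>) (\<lambda>t x. u1 t x \<omega>) (\<lambda>t x. u2 t x \<omega>)"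
    proof (intro reflected_pair.intro reflected_pair_axioms.intro)
      show "inner_L (\<lambda>x. u1 t x \<omega> - u2 t x \<omega>) (cosmode k) = inner_L (\<lambda>x. u1 s x \<omega> - u2 s x \<omega>) (cosmode k)
        - (eigenval k)\<^sup>2 / 2 * (LINT r|lebesgue_on {s..t}. inner_L (\<lambda>x. u1 r x \<omega> - u2 r x \<omega>) (cosmode k))
        + eigenval k / 2 * (slab_integral (\<eta>1 \<omega>) s t (\<lambda>z. cosmode k (snd z))
                          - slab_integral (\<eta>2 \<omega>) s t (\<lambda>z. cosmode k (snd z)))"
        if "s \<in> ?D" "t \<in> ?D" "s \<le> t" for s t k
        using elim(11) that by blast
      show "mean (\<lambda>x. u1 t x \<omega>) = mean (\<lambda>x. u1 s x \<omega>)" if "s \<in> ?D" "t \<in> ?D" "s \<le> t" for s t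
        using elim(9) that by blast
      show "mean (\<lambda>x. u2 t x \<omega>) = mean (\<lambda>x. u2 s x \<omega>)" if "s \<in> ?D" "t \<in> ?D" "s \<le> t" for s t
        using elim(10) that by blast
    qed (use elim(3-8) init mean0 \<open>0 < T\<close> in auto)
    then interpret reflected_pair T "\<eta>1 \<omega>" "\<eta>2 \<omega>" "\<lambda>t x. u1 t x \<omega>" "\<lambda>t x. u2 t x \<omega>" .
    have "u1 t x \<omega> = u2 t x \<omega>" if "t \<in> {0..T}" "x \<in> {0..1}" for t x
      using that u_eq[of t x] elim(3,4) by (cases "t = 0") auto
    then show ?case using measures_eq by blast
  qed
qed

end
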